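(* Let $n\ge2$ and $|q_{ij}|=1$ for $1\le i,j\le n$. The operator space generated by $G_i=S_i+S_i^*$, $1\le i\le n$ (the linear span of $G_1,\ldots,G_n$ in $\mathcal{B}(\Gamma_q(\mathbb{C}^n))$), is completely isomorphic to $E_n$.
   Context: Fix complex numbers $(q_{ij})_{1\le i,j\le n}$ with $|q_{ij}|=1$, $q_{ii}=1$ and $q_{ji}=q_{ij}^{-1}=\overline{q_{ij}}$. Let $\{e_1,\ldots,e_n\}$ be the standard basis of $\mathbb{C}^n$, $\Gamma(\mathbb{C}^n)=\bigoplus_{m\ge0}(\mathbb{C}^n)^{\otimes m}$ the full Fock space with vacuum $\omega$, and $V_ix=e_i\otimes x$ the left creation operators (with $e_i\otimes\omega=e_i$). For an $n$-tuple $\underline{R}$ of bounded operators on a Hilbert space $\mathcal{M}$, let $\mathcal{M}^q(\underline{R})$ be the largest closed subspace $\mathcal{N}\subseteq\mathcal{M}$ such that every $R_i^*$ leaves $\mathcal{N}$ invariant and $R_i^*R_j^*h=\overline{q_{ij}}R_j^*R_i^*h$ for all $h\in\mathcal{N}$ and all $i,j$ (it exists). Then $\Gamma_q(\mathbb{C}^n)=(\Gamma(\mathbb{C}^n))^q(V_1,\ldots,V_n)$ and $S_i=P_{\Gamma_q(\mathbb{C}^n)}V_i|_{\Gamma_q(\mathbb{C}^n)}$. With $\{e_{ij}\}$ the matrix units of $M_n=M_n(\mathbb{C})$, $E_n$ is the operator space $E_n=\{(\sum_{i=1}^nr_ie_{i1})\oplus(\sum_{i=1}^nr_ie_{1i}):r_1,\ldots,r_n\in\mathbb{C}\}\subset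 M_n\oplus M_n$. Two operator spaces are completely isomorphic if there is a linear bijection between them which is completely bounded with completely bounded inverse. *)

theory Defs
  imports "HOL-Analysis.Analysis"
begin

section \<open>Complex Hilbert spaces\<close>

class complex_inner = real_inner +
  fixes scaleC :: "complex \<Rightarrow> 'a \<Rightarrow> 'a" (infixr "*\<^sub>C" 75)
    and cinner :: "'a \<Rightarrow> 'a \<Rightarrow> complex"
  assumes scaleC_add_right: "a *\<^sub>C (x + y) = a *\<^sub>C x + a *\<^sub>C y"
    and scaleC_add_left: "(a + b) *\<^sub>C x = a *\<^sub>C x + b *\<^sub>C x"
    and scaleC_scaleC: "a *\<^sub>C (b *\<^sub>C x) = (a * b) *\<^sub>C x"
    and scaleC_of_real: "complex_of_real r *\<^sub>C x = r *\<^sub>R x"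
    and cinner_commute: "cinner x y = cnj (cinner y x)"
    and cinner_add_left: "cinner (x + y) z = cinner x z + cinner y z"
    and cinner_scaleC_left: "cinner (a *\<^sub>C x) y = a * cinner x y"
    and Re_cinner: "Re (cinner x y) = inner x y"

class complex_hilbert = complex_inner + complete_space

instantiation complex :: complex_hilbert
begin

definition "scaleC (a::complex) (x::complex) = a * x"
definition "cinner (x::complex) y = x * cnj y"

instance
  by standard
    (simp_all add: scaleC_complex_def cinner_complex_def inner_complex_def algebra_simps scaleR_conv_of_real)

end

instantiation vec :: (complex_hilbert, finite) complex_hilbert
begin

definition "scaleC a (x :: 'a ^ 'b) = (\<chi> i. a *\<^sub>C x $ i)"
definition "cinner (x :: 'a ^ 'b) y = (\<Sum>i\<in>UNIV. cinner (x $ i) (y $ i))"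

instance
proof
  fix x y :: "'a ^ 'b"
  show "cinner x y = cnj (cinner y x)"
    unfolding cinner_vec_def cnj_sum by (rule sum.cong[OF refl cinner_commute])
qed (simp_all add: scaleC_vec_def cinner_vec_def inner_vec_def vec_eq_iff scaleC_add_right
      scaleC_add_left scaleC_scaleC scaleC_of_real cinner_add_left cinner_scaleC_left
      sum.distrib sum_distrib_left Re_cinner)

end

instantiation prod :: (complex_hilbert, complex_hilbert) complex_hilbert
begin

definition "scaleC a (x :: 'a \<times> 'b) = (a *\<^sub>C fst x, a *\<^sub>C snd x)"
definition "cinner (x :: 'a \<times> 'b) y = cinner (fst x) (fst y) + cinner (snd x) (snd y)"

instance
proof
  fix x y :: "'a \<times> 'b"
  show "cinner x y = cnj (cinner y x)"
    unfolding cinner_prod_def complex_cnj_add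
    by (rule arg_cong2[where f="(+)", OF cinner_commute cinner_commute])
qed (simp_all add: scaleC_prod_def cinner_prod_def inner_prod_def scaleC_add_right
      scaleC_add_left scaleC_scaleC scaleC_of_real cinner_add_left cinner_scaleC_left
      algebra_simps Re_cinner prod_eq_iff)

end


section \<open>Square-summable families\<close>

definition square_summable :: "('a \<Rightarrow> complex) \<Rightarrow> bool" where
  "square_summable f \<longleftrightarrow> (\<lambda>x. (cmod (f x))\<^sup>2) summable_on UNIV"

lemma square_summable_add:
  assumes "square_summable f" "square_summable g"
  shows "square_summable (\<lambda>x. f x + g x)"
  unfolding square_summable_def
proof (rule summable_on_comparison_test)
  show "(\<lambda>x. 2 * (cmod (f x))\<^sup>2 + 2 * (cmod (g x))\<^sup>2) summable_on UNIV"
    using assms unfolding square_summable_def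
    by (intro summable_on_add summable_on_cmult_right)
  fix x
  have "(cmod (f x + g x))\<^sup>2 \<le> (cmod (f x) + cmod (g x))\<^sup>2"
    by (intro power_mono norm_triangle_ineq) auto
  also have "\<dots> \<le> 2 * (cmod (f x))\<^sup>2 + 2 * (cmod (g x))\<^sup>2"
    using sum_squares_bound[of "cmod (f x)" "cmod (g x)"] by (simp add: power2_sum)
  finally show "(cmod (f x + g x))\<^sup>2 \<le> 2 * (cmod (f x))\<^sup>2 + 2 * (cmod (g x))\<^sup>2" .
qed auto

lemma square_summable_mult:
  assumes "square_summable f"
  shows "square_summable (\<lambda>x. c * f x)"
  using assms unfolding square_summable_def
  by (simp add: norm_mult power_mult_distrib summable_on_cmult_right)

lemma square_summable_zero: "square_summable (\<lambda>_. 0)"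
  by (simp add: square_summable_def)

lemma square_summable_uminus:
  "square_summable f \<Longrightarrow> square_summable (\<lambda>x. - f x)"
  using square_summable_mult[of f "-1"] by simp

lemma square_summable_diff:
  "square_summable f \<Longrightarrow> square_summable g \<Longrightarrow> square_summable (\<lambda>x. f x - g x)"
  using square_summable_add[of f "\<lambda>x. - g x"] square_summable_uminus[of g] by simp

lemma square_summable_product:
  assumes "square_summable f" "square_summable g"
  shows "(\<lambda>x. f x * cnj (g x)) summable_on UNIV"
proof (rule abs_summable_summable[OF abs_summable_product])
qed (use assms in \<open>simp_all add: square_summable_def norm_mult power2_eq_square\<close>)

typedef 'a ell2 = "{f :: 'a \<Rightarrow> complex. square_summable f}"
  using square_summable_zero by blast

setup_lifting type_definition_ell2

lemma square_summable_Rep_ell2: "square_summable (Rep_ell2 f)"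
  using Rep_ell2 by blast

instantiation ell2 :: (type) complex_inner
begin

lift_definition zero_ell2 :: "'a ell2" is "\<lambda>_. 0"
  by (rule square_summable_zero)
lift_definition plus_ell2 :: "'a ell2 \<Rightarrow> 'a ell2 \<Rightarrow> 'a ell2" is "\<lambda>f g x. f x + g x"
  by (rule square_summable_add)
lift_definition minus_ell2 :: "'a ell2 \<Rightarrow> 'a ell2 \<Rightarrow> 'a ell2" is "\<lambda>f g x. f x - g x"
  by (rule square_summable_diff)
lift_definition uminus_ell2 :: "'a ell2 \<Rightarrow> 'a ell2" is "\<lambda>f x. - f x"
  by (rule square_summable_uminus)
lift_definition scaleC_ell2 :: "complex \<Rightarrow> 'a ell2 \<Rightarrow> 'a ell2" is "\<lambda>a f x. a * f x"
  by (rule square_summable_mult)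
lift_definition scaleR_ell2 :: "real \<Rightarrow> 'a ell2 \<Rightarrow> 'a ell2" is "\<lambda>r f x. complex_of_real r * f x"
  by (rule square_summable_mult)
lift_definition cinner_ell2 :: "'a ell2 \<Rightarrow> 'a ell2 \<Rightarrow> complex"
  is "\<lambda>f g. \<Sum>\<^sub>\<infinity>x. f x * cnj (g x)" .

definition "inner (f :: 'a ell2) g = Re (cinner f g)"
definition "norm (f :: 'a ell2) = sqrt (inner f f)"
definition "sgn (f :: 'a ell2) = inverse (norm f) *\<^sub>R f"
definition "dist (f :: 'a ell2) g = norm (f - g)"
definition
  "(uniformity :: ('a ell2 \<times> 'a ell2) filter) = (INF e\<in>{0 <..}. principal {(x, y). dist x y < e})"
definition
  "open (U :: 'a ell2 set) \<longleftrightarrow> (\<forall>x\<in>U. eventually (\<lambda>(x', y). x' = x \<longrightarrow> y \<in> U) uniformity)"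

instance
proof
  fix f g h :: "'a ell2" and a b :: complex and r s :: real
  show cc: "cinner f g = cnj (cinner g f)" for f g :: "'a ell2"
    by transfer (simp add: infsum_cnj[symmetric] mult.commute del: infsum_cnj)
  show ca: "cinner (f + g) h = cinner f h + cinner g h" for f g h :: "'a ell2"
    by transfer (simp add: distrib_right infsum_add square_summable_product)
  show cs: "cinner (a *\<^sub>C f) g = a * cinner f g" for a and f g :: "'a ell2"
    by transfer (simp add: mult.assoc infsum_cmult_right')
  show cr: "complex_of_real r *\<^sub>C f = r *\<^sub>R f" for r and f :: "'a ell2"
    by transfer simp
  have sq: "inner f f = (\<Sum>\<^sub>\<infinity>x. (cmod (Rep_ell2 f x))\<^sup>2)"
  proof -
    have "inner f f = (\<Sum>\<^sub>\<infinity>x. Re (Rep_ell2 f x * cnj (Rep_ell2 f x)))"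
      unfolding inner_ell2_def cinner_ell2.rep_eq
      by (rule infsum_Re[symmetric]) (intro square_summable_product square_summable_Rep_ell2)
    then show ?thesis by (simp add: complex_mult_cnj cmod_power2)
  qed
  show "Re (cinner f g) = inner f g"
    by (simp add: inner_ell2_def)
  show "inner f g = inner g f"
    using cc[of f g] by (simp add: inner_ell2_def)
  show "inner (f + g) h = inner f h + inner g h"
    by (simp add: inner_ell2_def ca)
  show "inner (r *\<^sub>R f) g = r * inner f g"
    by (simp add: inner_ell2_def cr[symmetric] cs)
  show "0 \<le> inner f f"
    unfolding sq by (intro infsum_nonneg) auto
  show "inner f f = 0 \<longleftrightarrow> f = 0"
  proof
    assume "inner f f = 0"
    then have "(cmod (Rep_ell2 f x))\<^sup>2 = 0" for x
      using nonneg_infsum_le_0D[of "\<lambda>x. (cmod (Rep_ell2 f x))\<^sup>2" UNIV x] square_summable_Rep_ell2[of f]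
      by (simp add: sq square_summable_def)
    then show "f = 0"
      by (simp add: Rep_ell2_inject[symmetric] zero_ell2.rep_eq fun_eq_iff)
  next
    assume "f = 0"
    then show "inner f f = 0" unfolding sq by (simp add: zero_ell2.rep_eq)
  qed
  show "f + g + h = f + (g + h)" by transfer (simp add: algebra_simps)
  show "f + g = g + f" by transfer (simp add: algebra_simps)
  show "0 + f = f" by transfer simp
  show "- f + f = 0" by transfer simp
  show "f - g = f + - g" by transfer simp
  show "r *\<^sub>R (f + g) = r *\<^sub>R f + r *\<^sub>R g" by transfer (simp add: algebra_simps)
  show "(r + s) *\<^sub>R f = r *\<^sub>R f + s *\<^sub>R f" by transfer (simp add: algebra_simps)
  show "r *\<^sub>R s *\<^sub>R f = (r * s) *\<^sub>R f" by transfer (simp add: algebra_simps)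
  show "1 *\<^sub>R f = f" by transfer simp
  show "sgn f = inverse (norm f) *\<^sub>R f" by (rule sgn_ell2_def)
  show "dist f g = norm (f - g)" by (rule dist_ell2_def)
  show "(uniformity :: ('a ell2 \<times> 'a ell2) filter) = (INF e\<in>{0 <..}. principal {(x, y). dist x y < e})"
    by (rule uniformity_ell2_def)
  show "open U \<longleftrightarrow> (\<forall>x\<in>U. \<forall>\<^sub>F (x', y) in uniformity. x' = x \<longrightarrow> y \<in> U)" for U :: "'a ell2 set"
    by (rule open_ell2_def)
  show "norm f = sqrt (inner f f)" by (rule norm_ell2_def)
  show "a *\<^sub>C (f + g) = a *\<^sub>C f + a *\<^sub>C g" by transfer (simp add: algebra_simps)
  show "(a + b) *\<^sub>C f = a *\<^sub>C f + b *\<^sub>C f" by transfer (simp add: algebra_simps)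
  show "a *\<^sub>C b *\<^sub>C f = (a * b) *\<^sub>C f" by transfer (simp add: algebra_simps)
qed

end

lemma norm_ell2_square: "(norm f)\<^sup>2 = (\<Sum>\<^sub>\<infinity>x. (cmod (Rep_ell2 f x))\<^sup>2)"
proof -
  have "(norm f)\<^sup>2 = inner f f"
    by (rule power2_norm_eq_inner)
  also have "\<dots> = (\<Sum>\<^sub>\<infinity>x. Re (Rep_ell2 f x * cnj (Rep_ell2 f x)))"
    unfolding inner_ell2_def cinner_ell2.rep_eq
    by (rule infsum_Re[symmetric]) (intro square_summable_product square_summable_Rep_ell2)
  finally show ?thesis by (simp add: complex_mult_cnj cmod_power2)
qed

lemma sum_le_norm_ell2:
  "finite F \<Longrightarrow> (\<Sum>x\<in>F. (cmod (Rep_ell2 f x))\<^sup>2) \<le> (norm f)\<^sup>2"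
  unfolding norm_ell2_square
  using square_summable_Rep_ell2[of f]
  by (intro finite_sum_le_infsum) (auto simp: square_summable_def)

instance ell2 :: (type) complex_hilbert
proof
  fix X :: "nat \<Rightarrow> 'a ell2"
  assume X: "Cauchy X"
  have coord: "cmod (Rep_ell2 f x) \<le> norm f" for f :: "'a ell2" and x
    using sum_le_norm_ell2[of "{x}" f] by (simp add: power2_le_iff_abs_le)
  have "Cauchy (\<lambda>n. Rep_ell2 (X n) x)" for x
  proof (rule CauchyI)
    fix e :: real assume "0 < e"
    then obtain M where M: "\<forall>m\<ge>M. \<forall>n\<ge>M. norm (X m - X n) < e"
      using X CauchyD by blast
    have "norm (Rep_ell2 (X m) x - Rep_ell2 (X n) x) < e" if "m \<ge> M" "n \<ge> M" for m n
      using coord[of "X m - X n" x] M that by (fastforce simp: minus_ell2.rep_eq)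
    then show "\<exists>M. \<forall>m\<ge>M. \<forall>n\<ge>M. norm (Rep_ell2 (X m) x - Rep_ell2 (X n) x) < e" by blast
  qed
  then have "\<forall>x. \<exists>l. (\<lambda>n. Rep_ell2 (X n) x) \<longlonglongrightarrow> l"
    by (simp add: Cauchy_convergent_iff convergent_def)
  then obtain L where L: "\<And>x. (\<lambda>n. Rep_ell2 (X n) x) \<longlonglongrightarrow> L x"
    by metis
  have bound: "(\<Sum>x\<in>F. (cmod (Rep_ell2 (X m) x - L x))\<^sup>2) \<le> e\<^sup>2"
    if "finite F" and M: "\<forall>n\<ge>M. norm (X m - X n) < e" for F m M e
  proof (rule LIMSEQ_le_const2)
    show "(\<lambda>n. \<Sum>x\<in>F. (cmod (Rep_ell2 (X m) x - Rep_ell2 (X n) x))\<^sup>2)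
        \<longlonglongrightarrow> (\<Sum>x\<in>F. (cmod (Rep_ell2 (X m) x - L x))\<^sup>2)"
      by (intro tendsto_intros L)
    have "(\<Sum>x\<in>F. (cmod (Rep_ell2 (X m) x - Rep_ell2 (X n) x))\<^sup>2) \<le> e\<^sup>2" if "n \<ge> M" for n
    proof -
      have "(\<Sum>x\<in>F. (cmod (Rep_ell2 (X m) x - Rep_ell2 (X n) x))\<^sup>2) \<le> (norm (X m - X n))\<^sup>2"
        using sum_le_norm_ell2[OF \<open>finite F\<close>, of "X m - X n"] by (simp add: minus_ell2.rep_eq)
      also have "\<dots> \<le> e\<^sup>2"
        using M that by (intro power_mono) (auto intro: less_imp_le)
      finally show ?thesis .
    qed
    then show "\<exists>N. \<forall>n\<ge>N. (\<Sum>x\<in>F. (cmod (Rep_ell2 (X m) x - Rep_ell2 (X n) x))\<^sup>2) \<le> e\<^sup>2"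
      by blast
  qed
  have summ: "square_summable (\<lambda>x. Rep_ell2 (X m) x - L x)"
    if M: "\<forall>n\<ge>M. norm (X m - X n) < e" for m M e
    unfolding square_summable_def
    by (rule nonneg_bdd_above_summable_on) (auto intro!: bdd_aboveI[of _ "e\<^sup>2"] bound[OF _ M])
  obtain M1 where "\<forall>m\<ge>M1. \<forall>n\<ge>M1. norm (X m - X n) < 1"
    using X CauchyD[of X 1] by auto
  then have "square_summable (\<lambda>x. Rep_ell2 (X M1) x - (Rep_ell2 (X M1) x - L x))"
    by (intro square_summable_diff square_summable_Rep_ell2 summ) auto
  then have sL: "square_summable L" by simp
  have "X \<longlonglongrightarrow> Abs_ell2 L"
  proof (rule LIMSEQ_I)
    fix e :: real assume e: "0 < e"
    then obtain M where M: "\<forall>m\<ge>M. \<forall>n\<ge>M. norm (X m - X n) < e / 2"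
      using X CauchyD[of X "e / 2"] by auto
    have "norm (X m - Abs_ell2 L) < e" if "m \<ge> M" for m
    proof -
      have R: "Rep_ell2 (X m - Abs_ell2 L) = (\<lambda>x. Rep_ell2 (X m) x - L x)"
        using sL by (simp add: minus_ell2.rep_eq Abs_ell2_inverse)
      have Mm: "\<forall>n\<ge>M. norm (X m - X n) < e / 2" using M that by blast
      have "(norm (X m - Abs_ell2 L))\<^sup>2 \<le> (e / 2)\<^sup>2"
        unfolding norm_ell2_square R
        by (rule infsum_le_finite_sums)
           (use summ[OF Mm] bound[OF _ Mm] in \<open>auto simp: square_summable_def\<close>)
      then have "norm (X m - Abs_ell2 L) \<le> e / 2"
        by (rule power2_le_imp_le) (use e in simp)
      then show ?thesis using e by simp
    qed
    then show "\<exists>no. \<forall>n\<ge>no. norm (X n - Abs_ell2 L) < e" by blast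
  qed
  then show "convergent X" by (auto simp: convergent_def)
qed


section \<open>Operators on closed subspaces\<close>

definition csubspace :: "'a::complex_inner set \<Rightarrow> bool" where
  "csubspace N \<longleftrightarrow> 0 \<in> N \<and> (\<forall>x\<in>N. \<forall>y\<in>N. x + y \<in> N) \<and> (\<forall>a. \<forall>x\<in>N. a *\<^sub>C x \<in> N)"

definition closed_csubspace :: "'a::complex_inner set \<Rightarrow> bool" where
  "closed_csubspace N \<longleftrightarrow> csubspace N \<and> closed N"

text \<open>
  The bounded linear operators on a closed subspace \<open>N\<close>. An operator on \<open>N\<close> is a function on the
  ambient type that takes the dummy value 0 outside \<open>N\<close>, so that equality, sums and scalar
  multiples of such functions are those of the operators on \<open>N\<close>.
\<close>

definition bounded_ops :: "'a::complex_inner set \<Rightarrow> ('a \<Rightarrow> 'a) set" where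
  "bounded_ops N = {T.
     (\<forall>x\<in>N. T x \<in> N) \<and>
     (\<forall>x. x \<notin> N \<longrightarrow> T x = 0) \<and>
     (\<forall>x\<in>N. \<forall>y\<in>N. T (x + y) = T x + T y) \<and>
     (\<forall>a. \<forall>x\<in>N. T (a *\<^sub>C x) = a *\<^sub>C T x) \<and>
     (\<exists>B. \<forall>x\<in>N. norm (T x) \<le> B * norm x)}"

definition adjoint_on :: "'a::complex_inner set \<Rightarrow> ('a \<Rightarrow> 'a) \<Rightarrow> 'a \<Rightarrow> 'a" where
  "adjoint_on N T =
     (THE T'. T' \<in> bounded_ops N \<and> (\<forall>x\<in>N. \<forall>y\<in>N. cinner (T x) y = cinner x (T' y)))"

definition orth_proj :: "'a::complex_inner set \<Rightarrow> 'a \<Rightarrow> 'a" where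
  "orth_proj N x = (THE y. y \<in> N \<and> (\<forall>z\<in>N. cinner (x - y) z = 0))"

definition compression :: "'a::complex_inner set \<Rightarrow> ('a \<Rightarrow> 'a) \<Rightarrow> 'a \<Rightarrow> 'a" where
  "compression N T x = (if x \<in> N then orth_proj N (T x) else 0)"


section \<open>Operator spaces\<close>

definition operator_space :: "'a::complex_inner set \<Rightarrow> ('a \<Rightarrow> 'a) set \<Rightarrow> bool" where
  "operator_space N X \<longleftrightarrow> closed_csubspace N \<and> X \<subseteq> bounded_ops N \<and>
     (\<lambda>_. 0) \<in> X \<and>
     (\<forall>S\<in>X. \<forall>T\<in>X. (\<lambda>x. S x + T x) \<in> X) \<and>
     (\<forall>a. \<forall>T\<in>X. (\<lambda>x. a *\<^sub>C T x) \<in> X)"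

text \<open>
  The operator norm of the \<open>k \<times> k\<close> matrix \<open>A\<close> over \<open>B(N)\<close>, acting on the
  \<open>k\<close>-fold Hilbert sum of \<open>N\<close>.
\<close>

definition matrix_norm :: "'a::complex_inner set \<Rightarrow> nat \<Rightarrow> (nat \<Rightarrow> nat \<Rightarrow> 'a \<Rightarrow> 'a) \<Rightarrow> real" where
  "matrix_norm N k A =
     (SUP h \<in> {h. (\<forall>j<k. h j \<in> N) \<and> (\<Sum>j<k. (norm (h j))\<^sup>2) \<le> 1}.
        sqrt (\<Sum>i<k. (norm (\<Sum>j<k. A i j (h j)))\<^sup>2))"

definition linear_map_on ::
  "('a::complex_inner \<Rightarrow> 'a) set \<Rightarrow> (('a \<Rightarrow> 'a) \<Rightarrow> ('b::complex_inner \<Rightarrow> 'b)) \<Rightarrow> bool" where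
  "linear_map_on X \<phi> \<longleftrightarrow>
     (\<forall>S\<in>X. \<forall>T\<in>X. \<phi> (\<lambda>x. S x + T x) = (\<lambda>y. \<phi> S y + \<phi> T y)) \<and>
     (\<forall>a. \<forall>T\<in>X. \<phi> (\<lambda>x. a *\<^sub>C T x) = (\<lambda>y. a *\<^sub>C \<phi> T y))"

definition completely_bounded ::
  "'a::complex_inner set \<Rightarrow> ('a \<Rightarrow> 'a) set \<Rightarrow> 'b::complex_inner set
    \<Rightarrow> (('a \<Rightarrow> 'a) \<Rightarrow> ('b \<Rightarrow> 'b)) \<Rightarrow> bool" where
  "completely_bounded N X M \<phi> \<longleftrightarrow>
     (\<exists>C. \<forall>k A. (\<forall>i<k. \<forall>j<k. A i j \<in> X) \<longrightarrow>
        matrix_norm M k (\<lambda>i j. \<phi> (A i j)) \<le> C * matrix_norm N k A)"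

text \<open>Here \<open>X\<close> consists of operators on \<open>N\<close>, and \<open>Y\<close> of operators on \<open>M\<close>.\<close>

definition completely_isomorphic ::
  "'a::complex_inner set \<Rightarrow> ('a \<Rightarrow> 'a) set \<Rightarrow> 'b::complex_inner set \<Rightarrow> ('b \<Rightarrow> 'b) set \<Rightarrow> bool" where
  "completely_isomorphic N X M Y \<longleftrightarrow> operator_space N X \<and> operator_space M Y \<and>
     (\<exists>\<phi>. linear_map_on X \<phi> \<and> bij_betw \<phi> X Y \<and>
        completely_bounded N X M \<phi> \<and> completely_bounded M Y N (inv_into X \<phi>))"

definition cspan_family :: "('n::finite \<Rightarrow> 'a::complex_inner \<Rightarrow> 'a) \<Rightarrow> ('a \<Rightarrow> 'a) set" where
  "cspan_family T = range (\<lambda>(c :: 'n \<Rightarrow> complex) x. \<Sum>i\<in>UNIV. c i *\<^sub>C T i x)"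


section \<open>The q-commuting Fock space\<close>

definition q_commuting_coinvariant ::
  "('n \<Rightarrow> 'n \<Rightarrow> complex) \<Rightarrow> ('n \<Rightarrow> 'a::complex_hilbert \<Rightarrow> 'a) \<Rightarrow> 'a set \<Rightarrow> bool" where
  "q_commuting_coinvariant q R N \<longleftrightarrow> closed_csubspace N \<and>
     (\<forall>i. \<forall>h\<in>N. adjoint_on UNIV (R i) h \<in> N) \<and>
     (\<forall>h\<in>N. \<forall>i j. adjoint_on UNIV (R i) (adjoint_on UNIV (R j) h) =
        cnj (q i j) *\<^sub>C adjoint_on UNIV (R j) (adjoint_on UNIV (R i) h))"

definition max_q_commuting_subspace ::
  "('n \<Rightarrow> 'n \<Rightarrow> complex) \<Rightarrow> ('n \<Rightarrow> 'a::complex_hilbert \<Rightarrow> 'a) \<Rightarrow> 'a set" where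
  "max_q_commuting_subspace q R = (GREATEST N. q_commuting_coinvariant q R N)"

text \<open>
  The full Fock space over \<open>\<complex>\<^sup>n\<close> is \<open>'n list ell2\<close>, where \<open>n = CARD('n)\<close>: the coefficient at a word
  \<open>[i\<^sub>1, \<dots>, i\<^sub>m]\<close> is the one at the orthonormal basis vector
  \<open>e\<^bsub>i\<^sub>1\<^esub> \<otimes> \<dots> \<otimes> e\<^bsub>i\<^sub>m\<^esub>\<close> of the \<open>m\<close>-th tensor power, and
  the empty word corresponds to the vacuum.
\<close>

lift_definition creation :: "'n \<Rightarrow> 'n list ell2 \<Rightarrow> 'n list ell2"
  is "\<lambda>i f w. case w of [] \<Rightarrow> 0 | j # u \<Rightarrow> if j = i then f u else 0"
proof -
  fix i :: 'n and f :: "'n list \<Rightarrow> complex"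
  let ?g = "\<lambda>w. case w of [] \<Rightarrow> 0 | j # u \<Rightarrow> if j = i then f u else 0"
  assume "square_summable f"
  then have "((\<lambda>w. (cmod (?g w))\<^sup>2) \<circ> (#) i) summable_on UNIV"
    by (simp add: square_summable_def o_def)
  then have "(\<lambda>w. (cmod (?g w))\<^sup>2) summable_on range ((#) i)"
    by (subst summable_on_reindex) (auto simp: inj_on_def)
  then show "square_summable ?g"
    unfolding square_summable_def
    by (rule summable_on_cong_neutral[THEN iffD1, rotated -1]) (auto split: list.splits)
qed

definition q_fock :: "('n \<Rightarrow> 'n \<Rightarrow> complex) \<Rightarrow> 'n list ell2 set" where
  "q_fock q = max_q_commuting_subspace q creation"

definition q_creation :: "('n \<Rightarrow> 'n \<Rightarrow> complex) \<Rightarrow> 'n \<Rightarrow> 'n list ell2 \<Rightarrow> 'n list ell2" where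
  "q_creation q i = compression (q_fock q) (creation i)"

definition q_gaussian :: "('n \<Rightarrow> 'n \<Rightarrow> complex) \<Rightarrow> 'n \<Rightarrow> 'n list ell2 \<Rightarrow> 'n list ell2" where
  "q_gaussian q i x = q_creation q i x + adjoint_on (q_fock q) (q_creation q i) x"


section \<open>The space of row and column matrices\<close>

definition matrix_unit :: "'n \<Rightarrow> 'n \<Rightarrow> complex ^ 'n ^ 'n" where
  "matrix_unit i j = (\<chi> a b. if a = i \<and> b = j then 1 else 0)"

definition block_diag ::
  "complex ^ 'n ^ 'n \<Rightarrow> complex ^ 'n ^ 'n \<Rightarrow> (complex ^ 'n) \<times> (complex ^ 'n) \<Rightarrow> (complex ^ 'n) \<times> (complex ^ 'n)"
  where "block_diag A B = (\<lambda>(x, y). (A *v x, B *v y))"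

text \<open>
  \<open>i1\<close> is the index that plays the role of 1, and \<open>M\<^sub>n \<oplus> M\<^sub>n\<close> is represented by the
  block diagonal operators on \<open>\<complex>\<^sup>n \<oplus> \<complex>\<^sup>n\<close>.
\<close>

definition E_space :: "'n::finite \<Rightarrow> ((complex ^ 'n) \<times> (complex ^ 'n) \<Rightarrow> (complex ^ 'n) \<times> (complex ^ 'n)) set" where
  "E_space i1 = range (\<lambda>r :: 'n \<Rightarrow> complex.
     block_diag (\<Sum>i\<in>UNIV. r i *\<^sub>C matrix_unit i i1) (\<Sum>i\<in>UNIV. r i *\<^sub>C matrix_unit i1 i))"

end

theory Submission
  imports Defs
begin

text \<open>
  On the q-commuting Fock space write \<open>P\<close> for the orthogonal projection onto it. Since that space is
  invariant under the annihilation operators \<open>V\<^sub>i\<^sup>*\<close>, the adjoint of \<open>S\<^sub>i = P V\<^sub>i\<close> is the restriction of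
  \<open>V\<^sub>i\<^sup>*\<close>, and \<open>\<Sum> r\<^sub>i G\<^sub>i = P (\<Sum> r\<^sub>i V\<^sub>i) + \<Sum> r\<^sub>i V\<^sub>i\<^sup>*\<close>. The same formula holds with matrices \<open>a\<^sub>i\<close> in place of
  the scalars \<open>r\<^sub>i\<close>, and there the two summands are controlled by the column and by the row formed from
  the \<open>a\<^sub>i\<close>. The isometries \<open>V\<^sub>i\<close> have orthogonal ranges, so \<open>\<Sum> a\<^sub>i \<otimes> V\<^sub>i\<close> has the norm of the column, and
  \<open>\<Sum> a\<^sub>i \<otimes> V\<^sub>i\<^sup>*\<close> has the norm of the row. Hence \<open>\<Sum> a\<^sub>i \<otimes> G\<^sub>i\<close> has at most twice the maximum of both.
  That maximum is exactly the norm of the corresponding matrix over \<open>E\<^sub>n\<close>.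

  Conversely, the q-commutation relations do not touch words of length at most one, so the vacuum and all
  \<open>e\<^sub>i\<close> lie in the q-commuting Fock space. Applied to the vacuum, \<open>\<Sum> a\<^sub>i \<otimes> G\<^sub>i\<close> displays the column; the
  vacuum component of its value on one-particle vectors displays the row. So its norm is at least the
  maximum of the two, and \<open>G\<^sub>i \<mapsto> e\<^bsub>i1\<^esub> \<oplus> e\<^bsub>1i\<^esub>\<close> is a complete isomorphism, completely contractive and with
  inverse of completely bounded norm at most 2.

  Both comparisons go through the predicate \<open>row_column_bound\<close>, which says that a number bounds the row and the
  column: the matrix norms over either space satisfy it (\<open>row_column_bound_row_column_op\<close>,
  \<open>row_column_bound_gaussian_op\<close>), and any nonnegative such number bounds them up to the factors 1 and 2
  (\<open>row_column_bound_matrix_norm_le\<close>, \<open>matrix_norm_gaussian_op_le\<close>).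
\<close>


section \<open>Orthogonal projections\<close>

lemma scaleC_minus_one: "(-1) *\<^sub>C (x::'a::complex_inner) = - x"
  using scaleC_of_real[of "-1" x] by simp

lemma scaleC_zero_left [simp]: "0 *\<^sub>C (x::'a::complex_inner) = 0"
  using scaleC_of_real[of 0 x] by simp

lemma scaleC_one [simp]: "1 *\<^sub>C (x::'a::complex_inner) = x"
  using scaleC_of_real[of 1 x] by simp

lemma scaleC_zero_right [simp]: "a *\<^sub>C (0::'a::complex_inner) = 0"
  using scaleC_add_right[of a 0 "0::'a"] by simp

lemma scaleC_sum_right: "a *\<^sub>C (\<Sum>i\<in>I. f i) = (\<Sum>i\<in>I. a *\<^sub>C (f i::'a::complex_inner))"
  by (induction I rule: infinite_finite_induct) (simp_all add: scaleC_add_right)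

lemma cinner_minus_left: "cinner (- x) y = - cinner (x::'a::complex_inner) y"
  by (metis cinner_scaleC_left mult_minus1 scaleC_minus_one)

lemma cinner_zero_left [simp]: "cinner 0 (x::'a::complex_inner) = 0"
  using cinner_scaleC_left[of 0 x x] by simp

lemma cinner_diff_left: "cinner (x - y) z = cinner x z - cinner (y::'a::complex_inner) z"
  using cinner_add_left[of x "- y" z] by (simp add: cinner_minus_left)

lemma cinner_scaleC_right: "cinner x (a *\<^sub>C y) = cnj a * cinner x (y::'a::complex_inner)"
  by (metis cinner_commute cinner_scaleC_left complex_cnj_mult)

lemma cinner_self: "cinner x x = complex_of_real ((norm (x::'a::complex_inner))\<^sup>2)"
proof (rule complex_eqI)
  show "Re (cinner x x) = Re (complex_of_real ((norm x)\<^sup>2))"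
    by (simp add: Re_cinner power2_norm_eq_inner)
  show "Im (cinner x x) = Im (complex_of_real ((norm x)\<^sup>2))"
    using arg_cong[OF cinner_commute[of x x], of Im] by simp
qed

lemma norm_scaleC: "norm (a *\<^sub>C x) = cmod a * norm (x::'a::complex_inner)"
proof -
  have "cinner (a *\<^sub>C x) (a *\<^sub>C x) = (a * cnj a) * cinner x x"
    by (simp add: cinner_scaleC_left cinner_scaleC_right)
  then have "complex_of_real ((norm (a *\<^sub>C x))\<^sup>2) = complex_of_real ((cmod a * norm x)\<^sup>2)"
    by (simp add: cinner_self complex_norm_square[symmetric] power_mult_distrib del: of_real_power)
  then have "(norm (a *\<^sub>C x))\<^sup>2 = (cmod a * norm x)\<^sup>2"
    by (simp only: of_real_eq_iff)
  then show ?thesis by (simp add: power2_eq_iff_nonneg)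
qed

lemma csubspace_diff: "csubspace N \<Longrightarrow> x \<in> N \<Longrightarrow> y \<in> N \<Longrightarrow> x - y \<in> N"
  unfolding csubspace_def by (metis add_uminus_conv_diff scaleC_minus_one)

lemma csubspace_scaleR: "csubspace N \<Longrightarrow> x \<in> N \<Longrightarrow> r *\<^sub>R x \<in> N"
  unfolding csubspace_def by (metis scaleC_of_real)

lemma csubspace_sum: "csubspace N \<Longrightarrow> (\<And>i. i \<in> I \<Longrightarrow> f i \<in> N) \<Longrightarrow> (\<Sum>i\<in>I. f i) \<in> N"
  by (induction I rule: infinite_finite_induct) (auto simp: csubspace_def)

lemma parallelogram:
  "(norm (x + y))\<^sup>2 + (norm (x - y))\<^sup>2 = 2 * (norm x)\<^sup>2 + 2 * (norm (y::'a::real_inner))\<^sup>2"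
  by (simp add: power2_norm_eq_inner inner_simps inner_commute)

text \<open>
  A minimizing sequence is Cauchy because, by the parallelogram law, two points of the subspace that
  nearly attain the distance to \<open>x\<close> are close to each other: their midpoint is no closer to \<open>x\<close>.
\<close>

lemma closest_point_exists:
  fixes N :: "'a::complex_hilbert set"
  assumes N: "closed_csubspace N"
  shows "\<exists>y\<in>N. \<forall>z\<in>N. norm (x - y) \<le> norm (x - z)"
proof -
  have sub: "csubspace N" and cl: "closed N" using N by (auto simp: closed_csubspace_def)
  define D where "D = (INF z\<in>N. (norm (x - z))\<^sup>2)"
  have ne: "N \<noteq> {}" using sub by (auto simp: csubspace_def)
  have bdd: "bdd_below ((\<lambda>z. (norm (x - z))\<^sup>2) ` N)" by (rule bdd_belowI[of _ 0]) auto
  have D_le: "D \<le> (norm (x - z))\<^sup>2" if "z \<in> N" for z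
    unfolding D_def using bdd that by (rule cINF_lower)
  have "\<exists>z\<in>N. (norm (x - z))\<^sup>2 < D + 1 / real (Suc n)" for n
    using cINF_less_iff[OF ne bdd, of "D + 1 / real (Suc n)"] by (simp add: D_def)
  then obtain Y where Y: "\<And>n. Y n \<in> N" "\<And>n. (norm (x - Y n))\<^sup>2 < D + 1 / real (Suc n)"
    by metis
  have dist_Y: "(norm (Y m - Y n))\<^sup>2 \<le> 2 / real (Suc m) + 2 / real (Suc n)" for m n
  proof -
    have mid: "(1/2) *\<^sub>R (Y m + Y n) \<in> N"
      using Y(1) sub by (intro csubspace_scaleR) (auto simp: csubspace_def)
    have "(x - Y m) + (x - Y n) = 2 *\<^sub>R (x - (1/2) *\<^sub>R (Y m + Y n))"
      by (simp add: algebra_simps scaleR_2)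
    then have "(norm ((x - Y m) + (x - Y n)))\<^sup>2 = 4 * (norm (x - (1/2) *\<^sub>R (Y m + Y n)))\<^sup>2"
      by (simp add: power_mult_distrib)
    then have "4 * D \<le> (norm ((x - Y m) + (x - Y n)))\<^sup>2"
      using D_le[OF mid] by simp
    moreover have "(x - Y m) - (x - Y n) = - (Y m - Y n)" by simp
    ultimately have "4 * D + (norm (Y m - Y n))\<^sup>2 \<le> 2 * (norm (x - Y m))\<^sup>2 + 2 * (norm (x - Y n))\<^sup>2"
      using parallelogram[of "x - Y m" "x - Y n"] by (metis add_right_mono norm_minus_cancel)
    then show ?thesis using Y(2)[of m] Y(2)[of n] by simp
  qed
  have "Cauchy Y"
  proof (rule CauchyI)
    fix e :: real assume e: "0 < e"
    then obtain M where M: "inverse (real (Suc M)) < e\<^sup>2 / 4"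
      using reals_Archimedean[of "e\<^sup>2 / 4"] by auto
    have "norm (Y m - Y n) < e" if "m \<ge> M" "n \<ge> M" for m n
    proof -
      have "1 / real (Suc m) \<le> inverse (real (Suc M))" "1 / real (Suc n) \<le> inverse (real (Suc M))"
        using that by (auto simp: field_simps)
      then have "(norm (Y m - Y n))\<^sup>2 < e\<^sup>2" using dist_Y[of m n] M by simp
      then show ?thesis using e by (simp add: power2_less_imp_less)
    qed
    then show "\<exists>M. \<forall>m\<ge>M. \<forall>n\<ge>M. norm (Y m - Y n) < e" by blast
  qed
  then obtain y where y: "Y \<longlonglongrightarrow> y" by (auto simp: Cauchy_convergent_iff convergent_def)
  have "y \<in> N" using closed_sequentially[OF cl _ y] Y(1) by blast
  have "(\<lambda>n. D + 1 / real (Suc n)) \<longlonglongrightarrow> D + 0"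
    unfolding inverse_eq_divide[symmetric]
    by (intro tendsto_add tendsto_const LIMSEQ_inverse_real_of_nat)
  moreover have "(\<lambda>n. (norm (x - Y n))\<^sup>2) \<longlonglongrightarrow> (norm (x - y))\<^sup>2"
    by (intro tendsto_intros y)
  ultimately have "(norm (x - y))\<^sup>2 \<le> D + 0"
    using Y(2) by (intro LIMSEQ_le[of "\<lambda>n. (norm (x - Y n))\<^sup>2" _ "\<lambda>n. D + 1 / real (Suc n)"])
      (auto intro: less_imp_le)
  then have y_le: "(norm (x - y))\<^sup>2 \<le> D" by simp
  have "norm (x - y) \<le> norm (x - z)" if "z \<in> N" for z
    by (rule power2_le_imp_le[OF order_trans[OF y_le D_le[OF that]] norm_ge_zero])
  then show ?thesis using \<open>y \<in> N\<close> by blast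
qed

text \<open>
  At a nearest point \<open>y\<close> of the subspace, moving by real multiples of \<open>z\<close> cannot decrease the distance, so the
  real inner product with \<open>z\<close> vanishes. Applied to \<open>\<i> *\<^sub>C z\<close> as well, this kills the imaginary part.
\<close>

lemma orthogonal_decomposition:
  fixes N :: "'a::complex_hilbert set"
  assumes N: "closed_csubspace N"
  shows "\<exists>y\<in>N. \<forall>z\<in>N. cinner (x - y) z = 0"
proof -
  have sub: "csubspace N" using N by (auto simp: closed_csubspace_def)
  obtain y where y: "y \<in> N" "\<And>z. z \<in> N \<Longrightarrow> norm (x - y) \<le> norm (x - z)"
    using closest_point_exists[OF N] by blast
  have real_orth: "inner (x - y) z = 0" if z: "z \<in> N" for z
  proof (cases "z = 0")
    case False
    \<comment> \<open>The distance from \<open>x - y\<close> to the line spanned by \<open>z\<close> is attained at \<open>t *\<^sub>R z\<close>.\<close>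
    define t where "t = inner (x - y) z / (norm z)\<^sup>2"
    have "y + t *\<^sub>R z \<in> N"
      using y(1) csubspace_scaleR[OF sub z] sub by (auto simp: csubspace_def)
    then have "(norm (x - y))\<^sup>2 \<le> (norm (x - (y + t *\<^sub>R z)))\<^sup>2"
      using y(2) by (simp add: power_mono)
    also have "x - (y + t *\<^sub>R z) = (x - y) - t *\<^sub>R z" by simp
    also have "(norm ((x - y) - t *\<^sub>R z))\<^sup>2
        = (norm (x - y))\<^sup>2 - 2 * t * inner (x - y) z + t\<^sup>2 * (norm z)\<^sup>2"
      unfolding power2_norm_eq_inner
      by (simp add: inner_diff_left inner_diff_right inner_commute power2_eq_square)
    finally have "2 * t * inner (x - y) z \<le> t\<^sup>2 * (norm z)\<^sup>2" by simp
    moreover have "inner (x - y) z = t * (norm z)\<^sup>2" using False by (simp add: t_def)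
    ultimately have "t\<^sup>2 * (norm z)\<^sup>2 \<le> 0" by (simp add: power2_eq_square)
    then have "t = 0" using False by (simp add: mult_le_0_iff)
    then show ?thesis using False by (simp add: t_def)
  qed simp
  have "cinner (x - y) z = 0" if z: "z \<in> N" for z
  proof (rule complex_eqI)
    show "Re (cinner (x - y) z) = Re 0"
      using real_orth[OF z] by (simp add: Re_cinner)
    have "\<i> *\<^sub>C z \<in> N" using z sub by (simp add: csubspace_def)
    then have "Re (cinner (x - y) (\<i> *\<^sub>C z)) = 0" using real_orth by (simp add: Re_cinner)
    then show "Im (cinner (x - y) z) = Im 0" by (simp add: cinner_scaleC_right)
  qed
  then show ?thesis using y(1) by blast
qed

lemma orth_proj_eqI:
  assumes sub: "csubspace N" and y: "y \<in> N" "\<And>z. z \<in> N \<Longrightarrow> cinner (x - y) z = 0"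
  shows "orth_proj N x = y"
  unfolding orth_proj_def
proof (rule the_equality)
  fix y' assume y': "y' \<in> N \<and> (\<forall>z\<in>N. cinner (x - y') z = 0)"
  have "y' - y \<in> N" using sub y y' by (simp add: csubspace_diff)
  then have "cinner (x - y) (y' - y) - cinner (x - y') (y' - y) = 0" using y y' by simp
  then have "cinner (y' - y) (y' - y) = 0"
    by (simp add: cinner_diff_left)
  then show "y' = y" by (simp add: cinner_self)
qed (use y in auto)

context
  fixes N :: "'a::complex_hilbert set"
  assumes N: "closed_csubspace N"
begin

lemma orth_proj_in: "orth_proj N x \<in> N"
  and orth_proj_orthogonal: "z \<in> N \<Longrightarrow> cinner (x - orth_proj N x) z = 0"
proof -
  obtain y where y: "y \<in> N" "\<forall>z\<in>N. cinner (x - y) z = 0"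
    using orthogonal_decomposition[OF N] by blast
  then have "orth_proj N x = y"
    using N by (intro orth_proj_eqI) (auto simp: closed_csubspace_def)
  with y show "orth_proj N x \<in> N" "z \<in> N \<Longrightarrow> cinner (x - orth_proj N x) z = 0" by auto
qed

lemma cinner_orth_proj: "z \<in> N \<Longrightarrow> cinner (orth_proj N x) z = cinner x z"
  using orth_proj_orthogonal[of z x] by (simp add: cinner_diff_left)

lemma orth_proj_id: "x \<in> N \<Longrightarrow> orth_proj N x = x"
  using N by (intro orth_proj_eqI) (auto simp: closed_csubspace_def cinner_diff_left)

lemma orth_proj_add: "orth_proj N (x + y) = orth_proj N x + orth_proj N y"
proof (rule orth_proj_eqI)
  show "csubspace N" using N by (simp add: closed_csubspace_def)
  then show "orth_proj N x + orth_proj N y \<in> N"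
    using orth_proj_in by (auto simp: csubspace_def)
qed (simp add: cinner_diff_left cinner_add_left cinner_orth_proj)

lemma orth_proj_scaleC: "orth_proj N (a *\<^sub>C x) = a *\<^sub>C orth_proj N x"
proof (rule orth_proj_eqI)
  show "csubspace N" using N by (simp add: closed_csubspace_def)
  then show "a *\<^sub>C orth_proj N x \<in> N"
    using orth_proj_in by (auto simp: csubspace_def)
qed (simp add: cinner_diff_left cinner_scaleC_left cinner_orth_proj)

lemma orth_proj_sum: "orth_proj N (\<Sum>i\<in>I. f i) = (\<Sum>i\<in>I. orth_proj N (f i))"
proof (induction I rule: infinite_finite_induct)
  case empty
  show ?case using N by (simp add: orth_proj_id closed_csubspace_def csubspace_def)
next
  case (infinite I)
  then show ?case using N by (simp add: orth_proj_id closed_csubspace_def csubspace_def)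
qed (simp add: orth_proj_add)

lemma norm_orth_proj_le: "norm (orth_proj N x) \<le> norm x"
proof -
  let ?p = "orth_proj N x"
  have "(norm ?p)\<^sup>2 = inner x ?p"
    using arg_cong[OF cinner_orth_proj[OF orth_proj_in], of Re, of x x]
    by (simp add: Re_cinner power2_norm_eq_inner)
  also have "\<dots> \<le> norm x * norm ?p" by (rule norm_cauchy_schwarz)
  finally show ?thesis
    by (cases "?p = 0") (auto simp: power2_eq_square)
qed

end


section \<open>Bounded operators and matrix norms\<close>

lemma bounded_ops_add:
  assumes "csubspace N" "S \<in> bounded_ops N" "T \<in> bounded_ops N"
  shows "(\<lambda>x. S x + T x) \<in> bounded_ops N"
proof -
  obtain B C where "\<forall>x\<in>N. norm (S x) \<le> B * norm x" "\<forall>x\<in>N. norm (T x) \<le> C * norm x"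
    using assms by (auto simp: bounded_ops_def)
  then have "\<forall>x\<in>N. norm (S x + T x) \<le> (B + C) * norm x"
    unfolding distrib_right by (blast intro: order_trans[OF norm_triangle_ineq] add_mono)
  then have "\<exists>B. \<forall>x\<in>N. norm (S x + T x) \<le> B * norm x" by blast
  then show ?thesis using assms
    by (simp add: bounded_ops_def csubspace_def scaleC_add_right add_ac)
qed

lemma bounded_ops_scaleC:
  assumes "csubspace N" "T \<in> bounded_ops N"
  shows "(\<lambda>x. a *\<^sub>C T x) \<in> bounded_ops N"
proof -
  obtain C where C: "\<forall>x\<in>N. norm (T x) \<le> C * norm x"
    using assms by (auto simp: bounded_ops_def)
  have "\<forall>x\<in>N. norm (a *\<^sub>C T x) \<le> (cmod a * C) * norm x"
    using mult_left_mono[OF bspec[OF C], of _ "cmod a"] by (simp add: norm_scaleC mult.assoc)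
  then have "\<exists>B. \<forall>x\<in>N. norm (a *\<^sub>C T x) \<le> B * norm x" by blast
  then show ?thesis using assms
    by (simp add: bounded_ops_def csubspace_def scaleC_add_right scaleC_scaleC mult.commute)
qed

lemma bounded_ops_zero: "csubspace N \<Longrightarrow> (\<lambda>_. 0) \<in> bounded_ops N"
  by (auto simp: bounded_ops_def csubspace_def intro: exI[of _ 0])

lemma bounded_ops_sum:
  "csubspace N \<Longrightarrow> (\<And>i. i \<in> I \<Longrightarrow> T i \<in> bounded_ops N) \<Longrightarrow> (\<lambda>x. \<Sum>i\<in>I. T i x) \<in> bounded_ops N"
  by (induction I rule: infinite_finite_induct) (auto simp: bounded_ops_zero bounded_ops_add)

lemma bounded_ops_apply_zero: "csubspace N \<Longrightarrow> T \<in> bounded_ops N \<Longrightarrow> T 0 = 0"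
proof -
  assume "csubspace N" "T \<in> bounded_ops N"
  then have "T (0 *\<^sub>C 0) = 0 *\<^sub>C T 0"
    unfolding bounded_ops_def csubspace_def by blast
  then show ?thesis by simp
qed

lemma bounded_ops_scaleR:
  "T \<in> bounded_ops N \<Longrightarrow> x \<in> N \<Longrightarrow> T (r *\<^sub>R x) = r *\<^sub>R T x"
  unfolding bounded_ops_def by (simp flip: scaleC_of_real)

lemma adjoint_on_eqI:
  assumes sub: "csubspace N" and T': "T' \<in> bounded_ops N"
    and adj: "\<And>x y. x \<in> N \<Longrightarrow> y \<in> N \<Longrightarrow> cinner (T x) y = cinner x (T' y)"
  shows "adjoint_on N T = T'"
  unfolding adjoint_on_def
proof (rule the_equality)
  fix U assume U: "U \<in> bounded_ops N \<and> (\<forall>x\<in>N. \<forall>y\<in>N. cinner (T x) y = cinner x (U y))"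
  show "U = T'"
  proof
    fix y
    show "U y = T' y"
    proof (cases "y \<in> N")
      case True
      let ?d = "U y - T' y"
      have d: "?d \<in> N" using True T' U sub by (auto simp: bounded_ops_def csubspace_diff)
      have "cinner ?d (U y) = cinner ?d (T' y)" using U adj True d by metis
      then have "cinner (U y) ?d = cinner (T' y) ?d" by (metis cinner_commute)
      then have "cinner ?d ?d = 0" by (simp add: cinner_diff_left)
      then show ?thesis by (simp add: cinner_self)
    next
      case False
      then show ?thesis using T' U by (simp add: bounded_ops_def)
    qed
  qed
qed (use T' adj in auto)

lemma compression_bounded_ops:
  fixes N :: "'a::complex_hilbert set"
  assumes N: "closed_csubspace N" and T: "T \<in> bounded_ops UNIV"
  shows "compression N T \<in> bounded_ops N"
proof -
  obtain B where B: "\<And>x. norm (T x) \<le> B * norm x" using T by (auto simp: bounded_ops_def)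
  have "\<forall>x\<in>N. norm (compression N T x) \<le> B * norm x"
    using order_trans[OF norm_orth_proj_le[OF N] B] by (simp add: compression_def)
  then show ?thesis
    using T N orth_proj_in[OF N]
    by (auto simp: bounded_ops_def compression_def closed_csubspace_def csubspace_def
        orth_proj_add[OF N] orth_proj_scaleC[OF N])
qed

text \<open>
  If the adjoint of \<open>T\<close> leaves \<open>N\<close> invariant, then it restricts to the adjoint of the compression,
  so no projection appears in the latter.
\<close>

lemma adjoint_on_compression:
  fixes N :: "'a::complex_hilbert set"
  assumes N: "closed_csubspace N" and L: "L \<in> bounded_ops UNIV"
    and adj: "\<And>x y. cinner (T x) y = cinner x (L y)"
    and inv: "\<And>x. x \<in> N \<Longrightarrow> L x \<in> N"
  shows "adjoint_on N (compression N T) = (\<lambda>x. if x \<in> N then L x else 0)"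
proof (rule adjoint_on_eqI)
  show sub: "csubspace N" using N by (simp add: closed_csubspace_def)
  show "(\<lambda>x. if x \<in> N then L x else 0) \<in> bounded_ops N"
    using L inv sub by (auto simp: bounded_ops_def csubspace_def)
qed (simp add: compression_def cinner_orth_proj[OF N] adj)

lemma matrix_norm_cong:
  assumes "\<And>i j. i < k \<Longrightarrow> j < k \<Longrightarrow> A i j = B i j"
  shows "matrix_norm N k A = matrix_norm N k B"
proof -
  have "(\<Sum>i<k. (norm (\<Sum>j<k. A i j (h j)))\<^sup>2) = (\<Sum>i<k. (norm (\<Sum>j<k. B i j (h j)))\<^sup>2)" for h
    using assms by simp
  then show ?thesis by (simp only: matrix_norm_def)
qed

text \<open>
  The supremum in the matrix norm is one of reals, hence meaningful only over a bounded set; a crude bound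
  in terms of bounds for the entries is enough.
\<close>

lemma matrix_norm_bdd:
  fixes k :: nat
  assumes A: "\<And>i j. i < k \<Longrightarrow> j < k \<Longrightarrow> A i j \<in> bounded_ops N"
  shows "bdd_above ((\<lambda>h. sqrt (\<Sum>i<k. (norm (\<Sum>j<k. A i j (h j)))\<^sup>2)) `
     {h. (\<forall>j<k. h j \<in> N) \<and> (\<Sum>j<k. (norm (h j))\<^sup>2) \<le> 1})"
proof -
  have "\<exists>B. \<forall>x\<in>N. norm (A i j x) \<le> B * norm x" if "i < k" "j < k" for i j
    using A[OF that] by (auto simp: bounded_ops_def)
  then obtain B where B: "\<And>i j x. i < k \<Longrightarrow> j < k \<Longrightarrow> x \<in> N \<Longrightarrow> norm (A i j x) \<le> B i j * norm x"
    by metis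
  show ?thesis
  proof (rule bdd_aboveI2)
    fix h assume "h \<in> {h. (\<forall>j<k. h j \<in> N) \<and> (\<Sum>j<k. (norm (h j))\<^sup>2) \<le> 1}"
    then have h: "\<And>j. j < k \<Longrightarrow> h j \<in> N" and h1: "(\<Sum>j<k. (norm (h j))\<^sup>2) \<le> 1" by auto
    have n1: "norm (h j) \<le> 1" if "j < k" for j
    proof -
      have "(norm (h j))\<^sup>2 \<le> (\<Sum>j<k. (norm (h j))\<^sup>2)"
        using that by (intro member_le_sum) auto
      then have "(norm (h j))\<^sup>2 \<le> 1\<^sup>2" using h1 by simp
      then show ?thesis by (rule power2_le_imp_le) simp
    qed
    have "norm (\<Sum>j<k. A i j (h j)) \<le> (\<Sum>j<k. \<bar>B i j\<bar>)" if "i < k" for i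
    proof (rule sum_norm_le)
      fix j assume j: "j \<in> {..<k}"
      have "norm (A i j (h j)) \<le> B i j * norm (h j)" using B that j h by simp
      also have "\<dots> \<le> \<bar>B i j\<bar> * 1"
        using n1 j by (intro mult_mono) auto
      finally show "norm (A i j (h j)) \<le> \<bar>B i j\<bar>" by simp
    qed
    then show "sqrt (\<Sum>i<k. (norm (\<Sum>j<k. A i j (h j)))\<^sup>2) \<le> sqrt (\<Sum>i<k. (\<Sum>j<k. \<bar>B i j\<bar>)\<^sup>2)"
      by (intro real_sqrt_le_mono sum_mono power_mono) auto
  qed
qed

lemma matrix_norm_ge:
  assumes A: "\<And>i j. i < k \<Longrightarrow> j < k \<Longrightarrow> A i j \<in> bounded_ops N"
    and h: "\<And>j. j < k \<Longrightarrow> h j \<in> N" "(\<Sum>j<k. (norm (h j))\<^sup>2) \<le> 1"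
  shows "sqrt (\<Sum>i<k. (norm (\<Sum>j<k. A i j (h j)))\<^sup>2) \<le> matrix_norm N k A"
  unfolding matrix_norm_def by (rule cSUP_upper[OF _ matrix_norm_bdd[OF A]]) (use h in auto)

lemma matrix_norm_nonneg:
  assumes "csubspace N" and A: "\<And>i j. i < k \<Longrightarrow> j < k \<Longrightarrow> A i j \<in> bounded_ops N"
  shows "0 \<le> matrix_norm N k A"
proof -
  have "0 \<le> sqrt (\<Sum>i<k. (norm (\<Sum>j<k. A i j 0))\<^sup>2)" by (simp add: sum_nonneg)
  also have "\<dots> \<le> matrix_norm N k A"
    using matrix_norm_ge[of k A N "\<lambda>_. 0"] assms by (auto simp: csubspace_def)
  finally show ?thesis .
qed

lemma matrix_norm_bound:
  assumes sub: "csubspace N" and A: "\<And>i j. i < k \<Longrightarrow> j < k \<Longrightarrow> A i j \<in> bounded_ops N"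
    and h: "\<And>j. j < k \<Longrightarrow> h j \<in> N"
  shows "(\<Sum>i<k. (norm (\<Sum>j<k. A i j (h j)))\<^sup>2) \<le> (matrix_norm N k A)\<^sup>2 * (\<Sum>j<k. (norm (h j))\<^sup>2)"
proof (cases "(\<Sum>j<k. (norm (h j))\<^sup>2) = 0")
  case True
  then have "\<forall>j\<in>{..<k}. (norm (h j))\<^sup>2 = 0"
    by (subst (asm) sum_nonneg_eq_0_iff) auto
  then have "h j = 0" if "j < k" for j using that by simp
  then have "(\<Sum>i<k. (norm (\<Sum>j<k. A i j (h j)))\<^sup>2) = 0"
    using bounded_ops_apply_zero[OF sub A] by simp
  then show ?thesis using True by simp
next
  case False
  let ?S = "\<Sum>j<k. (norm (h j))\<^sup>2"
  define t where "t = 1 / sqrt ?S"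
  have S: "?S > 0" using False by (simp add: less_le sum_nonneg)
  then have t2: "t\<^sup>2 * ?S = 1" by (simp add: t_def power_divide)
  have "(\<Sum>j<k. (norm (t *\<^sub>R h j))\<^sup>2) = t\<^sup>2 * ?S"
    by (simp add: power_mult_distrib sum_distrib_left)
  then have le: "sqrt (\<Sum>i<k. (norm (\<Sum>j<k. A i j (t *\<^sub>R h j)))\<^sup>2) \<le> matrix_norm N k A"
    using t2 by (intro matrix_norm_ge A csubspace_scaleR[OF sub] h) auto
  have "(\<Sum>i<k. (norm (\<Sum>j<k. A i j (t *\<^sub>R h j)))\<^sup>2)
      = (\<Sum>i<k. (norm (t *\<^sub>R (\<Sum>j<k. A i j (h j))))\<^sup>2)"
    using bounded_ops_scaleR[OF A h] by (simp add: scaleR_sum_right)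
  also have "\<dots> = t\<^sup>2 * (\<Sum>i<k. (norm (\<Sum>j<k. A i j (h j)))\<^sup>2)"
    by (simp add: power_mult_distrib sum_distrib_left)
  finally have "t\<^sup>2 * (\<Sum>i<k. (norm (\<Sum>j<k. A i j (h j)))\<^sup>2) \<le> (matrix_norm N k A)\<^sup>2"
    using power_mono[OF le, of 2] by (simp add: sum_nonneg)
  then have "(t\<^sup>2 * (\<Sum>i<k. (norm (\<Sum>j<k. A i j (h j)))\<^sup>2)) * ?S \<le> (matrix_norm N k A)\<^sup>2 * ?S"
    using S by (intro mult_right_mono) auto
  moreover have "(t\<^sup>2 * X) * ?S = X" for X using t2 by (simp add: mult.commute mult.left_commute)
  ultimately show ?thesis by simp
qed

lemma matrix_norm_leI:
  assumes sub: "csubspace N" and C: "0 \<le> C"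
    and bound: "\<And>h. (\<And>j. j < k \<Longrightarrow> h j \<in> N) \<Longrightarrow>
      (\<Sum>i<k. (norm (\<Sum>j<k. A i j (h j)))\<^sup>2) \<le> C\<^sup>2 * (\<Sum>j<k. (norm (h j))\<^sup>2)"
  shows "matrix_norm N k A \<le> C"
  unfolding matrix_norm_def
proof (rule cSUP_least)
  show "{h. (\<forall>j<k. h j \<in> N) \<and> (\<Sum>j<k. (norm (h j))\<^sup>2) \<le> 1} \<noteq> {}"
    using sub by (auto simp: csubspace_def intro!: exI[of _ "\<lambda>_. 0"])
  fix h assume h: "h \<in> {h. (\<forall>j<k. h j \<in> N) \<and> (\<Sum>j<k. (norm (h j))\<^sup>2) \<le> 1}"
  have "(\<Sum>i<k. (norm (\<Sum>j<k. A i j (h j)))\<^sup>2) \<le> C\<^sup>2 * (\<Sum>j<k. (norm (h j))\<^sup>2)"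
    using h by (intro bound) auto
  also have "\<dots> \<le> C\<^sup>2 * 1" using h by (intro mult_left_mono) auto
  finally show "sqrt (\<Sum>i<k. (norm (\<Sum>j<k. A i j (h j)))\<^sup>2) \<le> C"
    using C by (intro real_le_lsqrt) (auto simp: sum_nonneg)
qed


section \<open>The full Fock space\<close>

lemmas ell2_eqI = Rep_ell2_inject[THEN iffD1, OF ext]

lemma Rep_ell2_sum: "Rep_ell2 (\<Sum>i\<in>I. f i) w = (\<Sum>i\<in>I. Rep_ell2 (f i) w)"
  by (induction I rule: infinite_finite_induct) (simp_all add: zero_ell2.rep_eq plus_ell2.rep_eq)

lemmas Rep_ell2_simps = zero_ell2.rep_eq plus_ell2.rep_eq scaleC_ell2.rep_eq scaleR_ell2.rep_eq
  Rep_ell2_sum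

lemma norm_Rep_ell2_le: "cmod (Rep_ell2 f w) \<le> norm f"
  using sum_le_norm_ell2[of "{w}" f] by (simp add: power2_le_iff_abs_le)

lemma bounded_linear_Rep_ell2: "bounded_linear (\<lambda>f. Rep_ell2 f w)"
  by (rule bounded_linear_intro[where K=1])
     (simp_all add: Rep_ell2_simps scaleR_conv_of_real norm_Rep_ell2_le)

lift_definition basis_vec :: "'a \<Rightarrow> 'a ell2" is "\<lambda>w u. if u = w then 1 else 0"
  unfolding square_summable_def
  by (rule summable_on_cong_neutral[THEN iffD1, OF _ _ _ summable_on_finite[of "{w}" for w]]) auto

lemma cinner_basis_vec: "cinner f (basis_vec w) = Rep_ell2 f w"
proof -
  have "cinner f (basis_vec w) = (\<Sum>\<^sub>\<infinity>u. Rep_ell2 f u * cnj (if u = w then 1 else 0))"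
    by (simp add: cinner_ell2.rep_eq basis_vec.rep_eq)
  also have "\<dots> = (\<Sum>\<^sub>\<infinity>u\<in>{w}. Rep_ell2 f u)"
    by (rule infsum_cong_neutral) auto
  also have "\<dots> = Rep_ell2 f w" by simp
  finally show ?thesis .
qed

lemma norm_basis_vec: "norm (basis_vec w) = 1"
proof -
  have "complex_of_real ((norm (basis_vec w))\<^sup>2) = 1"
    unfolding cinner_self[symmetric] cinner_basis_vec by (simp add: basis_vec.rep_eq)
  then have "(norm (basis_vec w))\<^sup>2 = 1" by (simp only: of_real_eq_1_iff)
  then show ?thesis by (simp add: power2_eq_1_iff) (metis norm_ge_zero not_one_le_zero neg_0_le_iff_le)
qed

lift_definition annihilation :: "'n \<Rightarrow> 'n list ell2 \<Rightarrow> 'n list ell2" is "\<lambda>i f w. f (i # w)"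
proof -
  fix i :: 'n and f :: "'n list \<Rightarrow> complex"
  assume "square_summable f"
  then have "(\<lambda>w. (cmod (f w))\<^sup>2) summable_on range ((#) i)"
    unfolding square_summable_def by (rule summable_on_subset_banach) simp
  then have "((\<lambda>w. (cmod (f w))\<^sup>2) \<circ> (#) i) summable_on UNIV"
    by (subst (asm) summable_on_reindex) (auto simp: inj_on_def)
  then show "square_summable (\<lambda>w. f (i # w))" by (simp add: square_summable_def o_def)
qed

text \<open>The basis words other than the empty one split according to their first letter.\<close>

lemma norm_square_first_letter:
  fixes f :: "'n::finite list ell2"
  shows "(norm f)\<^sup>2 = (cmod (Rep_ell2 f []))\<^sup>2 + (\<Sum>a\<in>UNIV. (norm (annihilation a f))\<^sup>2)"
proof -
  let ?g = "\<lambda>w. (cmod (Rep_ell2 f w))\<^sup>2"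
  have s: "?g summable_on A" for A
    using square_summable_Rep_ell2[of f] unfolding square_summable_def
    by (rule summable_on_subset_banach) simp
  have U: "(UNIV :: 'n list set) = {[]} \<union> (\<Union>a. range ((#) a))"
    by (auto simp: image_iff neq_Nil_conv) (metis neq_Nil_conv)
  have "(norm f)\<^sup>2 = infsum ?g ({[]} \<union> (\<Union>a. range ((#) a)))"
    unfolding norm_ell2_square U[symmetric] ..
  also have "\<dots> = infsum ?g {[]} + infsum ?g (\<Union>a. range ((#) a))"
    by (intro infsum_Un_disjoint s) auto
  also have "infsum ?g (\<Union>a. range ((#) a)) = (\<Sum>a\<in>UNIV. infsum ?g (range ((#) a)))"
    by (rule sum_infsum[symmetric]) (use s in auto)
  also have "\<dots> = (\<Sum>a\<in>UNIV. (norm (annihilation a f))\<^sup>2)"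
    by (intro sum.cong refl, subst infsum_reindex)
       (auto simp: inj_on_def norm_ell2_square annihilation.rep_eq o_def)
  finally show ?thesis by simp
qed

lemma norm_annihilation_le: "norm (annihilation a f) \<le> norm (f :: 'n::finite list ell2)"
proof (rule power2_le_imp_le)
  have "(norm (annihilation a f))\<^sup>2 \<le> (\<Sum>a\<in>UNIV. (norm (annihilation a f))\<^sup>2)"
    by (rule member_le_sum) auto
  then show "(norm (annihilation a f))\<^sup>2 \<le> (norm f)\<^sup>2"
    by (simp add: norm_square_first_letter[of f] add_increasing)
qed simp

lemma annihilation_creation: "annihilation a (creation i f) = (if a = i then f else 0)"
  by (rule ell2_eqI) (simp add: annihilation.rep_eq creation.rep_eq zero_ell2.rep_eq)

lemma creation_Nil: "Rep_ell2 (creation i f) [] = 0"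
  by (simp add: creation.rep_eq)

lemma norm_creation: "norm (creation i f) = norm (f :: 'n::finite list ell2)"
proof -
  have "(norm (creation i f))\<^sup>2 = (\<Sum>a\<in>UNIV. (if a = i then (norm f)\<^sup>2 else 0))"
    unfolding norm_square_first_letter[of "creation i f"] annihilation_creation creation_Nil
    by (simp add: if_distrib[of norm] if_distrib[of "\<lambda>x. x\<^sup>2"] cong: if_cong)
  also have "\<dots> = (norm f)\<^sup>2" by simp
  finally show ?thesis by (simp add: power2_eq_iff_nonneg)
qed

lemma annihilation_add: "annihilation i (f + g) = annihilation i f + annihilation i g"
  and annihilation_scaleC: "annihilation i (a *\<^sub>C f) = a *\<^sub>C annihilation i f"
  by (rule ell2_eqI; simp add: annihilation.rep_eq Rep_ell2_simps)+

lemma annihilation_sum: "annihilation i (\<Sum>m\<in>I. F m) = (\<Sum>m\<in>I. annihilation i (F m))"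
  by (rule ell2_eqI) (simp add: annihilation.rep_eq Rep_ell2_simps)

lemma creation_bounded: "creation i \<in> bounded_ops (UNIV :: 'n::finite list ell2 set)"
proof -
  have "creation i (f + g) = creation i f + creation i g" for f g :: "'n list ell2"
    by (rule ell2_eqI) (auto simp: creation.rep_eq Rep_ell2_simps split: list.split)
  moreover have "creation i (a *\<^sub>C f) = a *\<^sub>C creation i f" for a and f :: "'n list ell2"
    by (rule ell2_eqI) (auto simp: creation.rep_eq Rep_ell2_simps split: list.split)
  ultimately show ?thesis by (auto simp: bounded_ops_def norm_creation intro: exI[of _ 1])
qed

lemma annihilation_bounded: "annihilation i \<in> bounded_ops (UNIV :: 'n::finite list ell2 set)"
  by (auto simp: bounded_ops_def annihilation_add annihilation_scaleC norm_annihilation_le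
      intro!: exI[of _ 1])

lemma cinner_creation: "cinner (creation i f) g = cinner f (annihilation i g)"
proof -
  have "cinner (creation i f) g = (\<Sum>\<^sub>\<infinity>w\<in>range ((#) i). Rep_ell2 (creation i f) w * cnj (Rep_ell2 g w))"
    unfolding cinner_ell2.rep_eq
    by (rule infsum_cong_neutral) (auto simp: creation.rep_eq split: list.splits)
  also have "\<dots> = cinner f (annihilation i g)"
    by (subst infsum_reindex)
       (auto simp: inj_on_def cinner_ell2.rep_eq creation.rep_eq annihilation.rep_eq o_def)
  finally show ?thesis .
qed

lemma adjoint_creation: "adjoint_on UNIV (creation i) = annihilation (i :: 'n::finite)"
  by (rule adjoint_on_eqI)
     (auto simp: annihilation_bounded cinner_creation csubspace_def)


section \<open>The q-commuting Fock space\<close>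

text \<open>
  Applying annihilation operators strips leading letters, so the commutation relations on a coinvariant
  subspace say that interchanging two adjacent letters, anywhere in a word, multiplies the coefficient by
  a fixed scalar.
\<close>

lemma q_fock_eq:
  fixes q :: "'n::finite \<Rightarrow> 'n \<Rightarrow> complex"
  shows "q_fock q = {f. \<forall>u v i j. Rep_ell2 f (u @ j # i # v) = cnj (q i j) * Rep_ell2 f (u @ i # j # v)}"
    (is "_ = ?N")
  and q_fock_closed_csubspace: "closed_csubspace (q_fock q)"
  and q_fock_annihilation: "\<And>f a. f \<in> q_fock q \<Longrightarrow> annihilation a f \<in> q_fock q"
proof -
  have "closed {f. Rep_ell2 f w = c * Rep_ell2 f w'}" for w w' :: "'n list" and c
    by (intro closed_Collect_eq continuous_intros bounded_linear.continuous_on[OF bounded_linear_Rep_ell2])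
  then have "closed ?N" by (intro closed_Collect_all)
  moreover have "csubspace ?N"
    unfolding csubspace_def mem_Collect_eq
  proof (intro conjI ballI allI)
    fix u v i j a and f g
    show "Rep_ell2 0 (u @ j # i # v) = cnj (q i j) * Rep_ell2 0 (u @ i # j # v)"
      by (simp add: zero_ell2.rep_eq)
    assume f: "f \<in> ?N"
    then have fe: "Rep_ell2 f (u @ j # i # v) = cnj (q i j) * Rep_ell2 f (u @ i # j # v)" by blast
    show "Rep_ell2 (a *\<^sub>C f) (u @ j # i # v) = cnj (q i j) * Rep_ell2 (a *\<^sub>C f) (u @ i # j # v)"
      unfolding scaleC_ell2.rep_eq fe by (rule mult.left_commute)
    assume "g \<in> ?N"
    then have ge: "Rep_ell2 g (u @ j # i # v) = cnj (q i j) * Rep_ell2 g (u @ i # j # v)" by blast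
    show "Rep_ell2 (f + g) (u @ j # i # v) = cnj (q i j) * Rep_ell2 (f + g) (u @ i # j # v)"
      unfolding plus_ell2.rep_eq fe ge by (rule distrib_left[symmetric])
  qed
  ultimately have cc: "closed_csubspace ?N" by (simp add: closed_csubspace_def)
  have inv: "annihilation a f \<in> ?N" if "f \<in> ?N" for a f
    unfolding mem_Collect_eq annihilation.rep_eq append_Cons[symmetric] using that by blast
  have co: "q_commuting_coinvariant q creation ?N"
    unfolding q_commuting_coinvariant_def adjoint_creation
  proof (intro conjI cc allI ballI inv)
    fix f i j assume f: "f \<in> ?N"
    show "annihilation i (annihilation j f) = cnj (q i j) *\<^sub>C annihilation j (annihilation i f)"
    proof (rule ell2_eqI)
      fix w
      have "Rep_ell2 f ([] @ j # i # w) = cnj (q i j) * Rep_ell2 f ([] @ i # j # w)"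
        using f by blast
      then show "Rep_ell2 (annihilation i (annihilation j f)) w
          = Rep_ell2 (cnj (q i j) *\<^sub>C annihilation j (annihilation i f)) w"
        unfolding annihilation.rep_eq scaleC_ell2.rep_eq append_Nil .
    qed
  qed
  have greatest: "M \<subseteq> ?N" if M: "q_commuting_coinvariant q creation M" for M
  proof -
    have "f \<in> M \<longrightarrow> Rep_ell2 f (u @ j # i # v) = cnj (q i j) * Rep_ell2 f (u @ i # j # v)" for f u i j v
    proof (induction u arbitrary: f)
      case Nil
      show ?case
      proof
        assume "f \<in> M"
        then have "annihilation i (annihilation j f) = cnj (q i j) *\<^sub>C annihilation j (annihilation i f)"
          using M unfolding q_commuting_coinvariant_def adjoint_creation by blast
        from arg_cong[OF this, of "\<lambda>g. Rep_ell2 g v"]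
        show "Rep_ell2 f ([] @ j # i # v) = cnj (q i j) * Rep_ell2 f ([] @ i # j # v)"
          unfolding annihilation.rep_eq scaleC_ell2.rep_eq append_Nil .
      qed
    next
      case (Cons a u)
      show ?case
      proof
        assume "f \<in> M"
        then have "annihilation a f \<in> M"
          using M by (simp add: q_commuting_coinvariant_def adjoint_creation)
        then show "Rep_ell2 f ((a # u) @ j # i # v) = cnj (q i j) * Rep_ell2 f ((a # u) @ i # j # v)"
          using Cons.IH[of "annihilation a f"] by (simp add: annihilation.rep_eq)
      qed
    qed
    then show ?thesis by blast
  qed
  show eq: "q_fock q = ?N"
    unfolding q_fock_def max_q_commuting_subspace_def
    by (rule Greatest_equality) (use co greatest in auto)
  show "closed_csubspace (q_fock q)" using cc by (simp add: eq)
  show "\<And>f a. f \<in> q_fock q \<Longrightarrow> annihilation a f \<in> q_fock q" using inv unfolding eq .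
qed

lemma q_fock_csubspace: "csubspace (q_fock (q :: 'n::finite \<Rightarrow> 'n \<Rightarrow> complex))"
  using q_fock_closed_csubspace by (auto simp: closed_csubspace_def)

text \<open>The relations only concern words with at least two letters.\<close>

lemma basis_vec_in_q_fock:
  assumes "length w \<le> 1"
  shows "basis_vec w \<in> q_fock (q :: 'n::finite \<Rightarrow> 'n \<Rightarrow> complex)"
proof -
  have "u @ i # j # v \<noteq> w" for u i j v using assms by auto
  then show ?thesis by (auto simp: q_fock_eq basis_vec.rep_eq)
qed

lemma q_gaussian_apply:
  assumes "f \<in> q_fock (q :: 'n::finite \<Rightarrow> 'n \<Rightarrow> complex)"
  shows "q_gaussian q i f = orth_proj (q_fock q) (creation i f) + annihilation i f"
  unfolding q_gaussian_def q_creation_def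
  by (subst adjoint_on_compression[OF q_fock_closed_csubspace annihilation_bounded cinner_creation
        q_fock_annihilation])
     (use assms in \<open>simp_all add: compression_def\<close>)

lemma q_gaussian_bounded:
  fixes q :: "'n::finite \<Rightarrow> 'n \<Rightarrow> complex"
  shows "q_gaussian q i \<in> bounded_ops (q_fock q)"
proof -
  have "(\<lambda>f. if f \<in> q_fock q then annihilation i f else 0) \<in> bounded_ops (q_fock q)"
    using annihilation_bounded[of i] q_fock_annihilation[of _ q i] q_fock_csubspace[of q]
    by (auto simp: bounded_ops_def csubspace_def)
  moreover have "adjoint_on (q_fock q) (q_creation q i) = (\<lambda>f. if f \<in> q_fock q then annihilation i f else 0)"
    unfolding q_creation_def
    by (rule adjoint_on_compression[OF q_fock_closed_csubspace annihilation_bounded cinner_creation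
        q_fock_annihilation])
  moreover have "q_creation q i \<in> bounded_ops (q_fock q)"
    unfolding q_creation_def by (rule compression_bounded_ops[OF q_fock_closed_csubspace creation_bounded])
  ultimately show ?thesis
    using bounded_ops_add[OF q_fock_csubspace] unfolding q_gaussian_def[abs_def] by metis
qed


section \<open>Row and column estimates\<close>

text \<open>
  The first part says that the column with the matrix entries \<open>c _ _ a\<close> for all letters \<open>a\<close>, mapping \<open>\<complex>\<^sup>k\<close> to
  \<open>\<complex>\<^sup>k \<otimes> \<complex>\<^sup>n\<close>, has norm at most \<open>\<bar>M\<bar>\<close>; the second part says the same of the row, which maps \<open>\<complex>\<^sup>k \<otimes> \<complex>\<^sup>n\<close>
  to \<open>\<complex>\<^sup>k\<close>.
\<close>

definition row_column_bound :: "nat \<Rightarrow> (nat \<Rightarrow> nat \<Rightarrow> 'n::finite \<Rightarrow> complex) \<Rightarrow> real \<Rightarrow> bool" where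
  "row_column_bound k c M \<longleftrightarrow>
     (\<forall>x. (\<Sum>i<k. \<Sum>a\<in>UNIV. (cmod (\<Sum>j<k. c i j a * x j))\<^sup>2) \<le> M\<^sup>2 * (\<Sum>j<k. (cmod (x j))\<^sup>2)) \<and>
     (\<forall>y. (\<Sum>i<k. (cmod (\<Sum>j<k. \<Sum>m\<in>UNIV. c i j m * y j m))\<^sup>2)
        \<le> M\<^sup>2 * (\<Sum>j<k. \<Sum>m\<in>UNIV. (cmod (y j m))\<^sup>2))"

definition row_column_op :: "'n::finite \<Rightarrow> ('n \<Rightarrow> complex) \<Rightarrow> (complex ^ 'n) \<times> (complex ^ 'n) \<Rightarrow> (complex ^ 'n) \<times> (complex ^ 'n)" where
  "row_column_op i1 r = block_diag (\<Sum>i\<in>UNIV. r i *\<^sub>C matrix_unit i i1) (\<Sum>i\<in>UNIV. r i *\<^sub>C matrix_unit i1 i)"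

definition gaussian_op :: "('n::finite \<Rightarrow> 'n \<Rightarrow> complex) \<Rightarrow> ('n \<Rightarrow> complex) \<Rightarrow> 'n list ell2 \<Rightarrow> 'n list ell2" where
  "gaussian_op q r = (\<lambda>f. \<Sum>i\<in>UNIV. r i *\<^sub>C q_gaussian q i f)"

lemma E_space_eq: "E_space i1 = range (row_column_op i1)"
  by (simp add: E_space_def row_column_op_def)

lemma cspan_q_gaussian_eq: "cspan_family (q_gaussian q) = range (gaussian_op q)"
  by (simp add: cspan_family_def gaussian_op_def)

subsection \<open>Row and column matrices\<close>

lemma row_column_op_apply:
  "row_column_op i1 r z =
     (\<chi> a. r a * fst z $ i1, \<chi> a. if a = i1 then \<Sum>m\<in>UNIV. r m * snd z $ m else 0)"
proof -
  have "(\<Sum>i\<in>UNIV. r i *\<^sub>C matrix_unit i i1) $ a $ b = (if b = i1 then r a else 0)" for a b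
    by (simp add: sum_component scaleC_vec_def scaleC_complex_def matrix_unit_def if_distrib sum.If_cases
        cong: if_cong)
  moreover have "(\<Sum>i\<in>UNIV. r i *\<^sub>C matrix_unit i1 i) $ a $ b = (if a = i1 then r b else 0)" for a b
    by (simp add: sum_component scaleC_vec_def scaleC_complex_def matrix_unit_def if_distrib sum.If_cases
        cong: if_cong)
  ultimately show ?thesis
    by (simp add: row_column_op_def block_diag_def case_prod_beta vec_eq_iff matrix_vector_mult_def
        if_distrib[of "\<lambda>t. t * _"] cong: if_cong)
qed

lemma row_column_op_bounded: "row_column_op i1 r \<in> bounded_ops UNIV"
proof -
  have add: "row_column_op i1 r (x + y) = row_column_op i1 r x + row_column_op i1 r y" for x y
    by (simp add: row_column_op_apply vec_eq_iff distrib_left sum.distrib)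
  have scale: "row_column_op i1 r (a *\<^sub>C x) = a *\<^sub>C row_column_op i1 r x" for a x
    by (simp add: row_column_op_apply vec_eq_iff scaleC_prod_def scaleC_vec_def scaleC_complex_def
        sum_distrib_left mult.left_commute)
  have "linear (row_column_op i1 r)"
    by (rule linearI) (simp_all add: add scale scaleC_of_real[symmetric])
  then obtain B where "\<forall>x. norm (row_column_op i1 r x) \<le> B * norm x"
    using linear_bounded by blast
  then show ?thesis using add scale by (auto simp: bounded_ops_def)
qed

lemma row_column_op_linear:
  "row_column_op i1 (\<lambda>a. r a + s a) = (\<lambda>z. row_column_op i1 r z + row_column_op i1 s z)"
  "row_column_op i1 (\<lambda>a. b * r a) = (\<lambda>z. b *\<^sub>C row_column_op i1 r z)"
  by (simp_all add: fun_eq_iff row_column_op_apply vec_eq_iff scaleC_prod_def scaleC_vec_def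
      scaleC_complex_def distrib_right sum.distrib sum_distrib_left mult.assoc)

lemma inj_row_column_op: "inj (row_column_op i1)"
proof (rule injI)
  fix r s :: "'a \<Rightarrow> complex"
  assume "row_column_op i1 r = row_column_op i1 s"
  then have "fst (row_column_op i1 r (\<chi> _. 1, 0)) $ a = fst (row_column_op i1 s (\<chi> _. 1, 0)) $ a" for a by simp
  then show "r = s" by (simp add: row_column_op_apply fun_eq_iff)
qed

lemma norm_vec_square: "(norm x)\<^sup>2 = (\<Sum>i\<in>UNIV. (cmod (x $ i))\<^sup>2)" for x :: "complex ^ 'n"
  by (simp add: norm_vec_def L2_set_def sum_nonneg)

lemma norm_prod_square: "(norm z)\<^sup>2 = (norm (fst z))\<^sup>2 + (norm (snd z))\<^sup>2"
  by (simp add: norm_prod_def case_prod_beta)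

lemma norm_sum_row_column_op:
  "(norm (\<Sum>j\<in>J. row_column_op i1 (c j) (h j)))\<^sup>2 =
     (\<Sum>a\<in>UNIV. (cmod (\<Sum>j\<in>J. c j a * fst (h j) $ i1))\<^sup>2) +
     (cmod (\<Sum>j\<in>J. \<Sum>m\<in>UNIV. c j m * snd (h j) $ m))\<^sup>2"
proof -
  have "(\<Sum>j\<in>J. row_column_op i1 (c j) (h j)) =
     (\<chi> a. \<Sum>j\<in>J. c j a * fst (h j) $ i1,
      \<chi> a. if a = i1 then \<Sum>j\<in>J. \<Sum>m\<in>UNIV. c j m * snd (h j) $ m else 0)"
    by (simp add: prod_eq_iff fst_sum snd_sum vec_eq_iff sum_component row_column_op_apply)
  then show ?thesis
    by (simp add: norm_prod_square norm_vec_square if_distrib[of cmod] if_distrib[of "\<lambda>t. t\<^sup>2"] cong: if_cong)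
qed

lemma row_column_bound_matrix_norm_le:
  assumes M: "row_column_bound k c M" "0 \<le> M"
  shows "matrix_norm UNIV k (\<lambda>i j. row_column_op i1 (c i j)) \<le> M"
proof (rule matrix_norm_leI)
  fix h :: "nat \<Rightarrow> (complex ^ 'a) \<times> (complex ^ 'a)"
  have "(\<Sum>i<k. (norm (\<Sum>j<k. row_column_op i1 (c i j) (h j)))\<^sup>2)
      = (\<Sum>i<k. \<Sum>a\<in>UNIV. (cmod (\<Sum>j<k. c i j a * fst (h j) $ i1))\<^sup>2)
        + (\<Sum>i<k. (cmod (\<Sum>j<k. \<Sum>m\<in>UNIV. c i j m * snd (h j) $ m))\<^sup>2)"
    by (simp add: norm_sum_row_column_op sum.distrib)
  also have "\<dots> \<le> M\<^sup>2 * (\<Sum>j<k. (cmod (fst (h j) $ i1))\<^sup>2)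
      + M\<^sup>2 * (\<Sum>j<k. \<Sum>m\<in>UNIV. (cmod (snd (h j) $ m))\<^sup>2)"
    using M(1)[unfolded row_column_bound_def, THEN conjunct1, THEN spec, of "\<lambda>j. fst (h j) $ i1"]
      M(1)[unfolded row_column_bound_def, THEN conjunct2, THEN spec, of "\<lambda>j m. snd (h j) $ m"]
    by (rule add_mono)
  also have "\<dots> \<le> M\<^sup>2 * (\<Sum>j<k. (norm (fst (h j)))\<^sup>2) + M\<^sup>2 * (\<Sum>j<k. (norm (snd (h j)))\<^sup>2)"
    by (intro add_mono mult_left_mono sum_mono power_mono Finite_Cartesian_Product.norm_nth_le) (simp_all add: norm_vec_square)
  also have "\<dots> = M\<^sup>2 * (\<Sum>j<k. (norm (h j))\<^sup>2)"
    unfolding norm_prod_square[of "h _"] sum.distrib distrib_left ..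
  finally show "(\<Sum>i<k. (norm (\<Sum>j<k. row_column_op i1 (c i j) (h j)))\<^sup>2) \<le> M\<^sup>2 * (\<Sum>j<k. (norm (h j))\<^sup>2)" .
qed (use M in \<open>auto simp: csubspace_def\<close>)

text \<open>
  The column acts on the multiples of the basis vector at \<open>i1\<close> in the first summand, the row on the second
  summand.
\<close>

lemma row_column_bound_row_column_op:
  "row_column_bound k c (matrix_norm UNIV k (\<lambda>i j. row_column_op i1 (c i j)))"
  (is "row_column_bound k c ?M")
proof -
  have bound: "(\<Sum>i<k. (norm (\<Sum>j<k. row_column_op i1 (c i j) (h j)))\<^sup>2) \<le> ?M\<^sup>2 * (\<Sum>j<k. (norm (h j))\<^sup>2)" for h
    by (rule matrix_norm_bound) (auto simp: row_column_op_bounded csubspace_def)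
  show ?thesis
    unfolding row_column_bound_def
  proof (intro conjI allI)
    fix x :: "nat \<Rightarrow> complex"
    show "(\<Sum>i<k. \<Sum>a\<in>UNIV. (cmod (\<Sum>j<k. c i j a * x j))\<^sup>2) \<le> ?M\<^sup>2 * (\<Sum>j<k. (cmod (x j))\<^sup>2)"
    proof -
      have "(norm (\<chi> a. if a = i1 then x j else 0, 0 :: complex ^ 'a))\<^sup>2 = (cmod (x j))\<^sup>2" for j
        by (simp add: norm_prod_square norm_vec_square if_distrib[of cmod] if_distrib[of "\<lambda>t. t\<^sup>2"]
            cong: if_cong)
      then show ?thesis
        using bound[of "\<lambda>j. (\<chi> a. if a = i1 then x j else 0, 0)"]
        by (simp add: norm_sum_row_column_op)
    qed
  next
    fix y :: "nat \<Rightarrow> 'a \<Rightarrow> complex"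
    show "(\<Sum>i<k. (cmod (\<Sum>j<k. \<Sum>m\<in>UNIV. c i j m * y j m))\<^sup>2)
        \<le> ?M\<^sup>2 * (\<Sum>j<k. \<Sum>m\<in>UNIV. (cmod (y j m))\<^sup>2)"
    proof -
      have "(norm (0 :: complex ^ 'a, \<chi> m. y j m))\<^sup>2 = (\<Sum>m\<in>UNIV. (cmod (y j m))\<^sup>2)" for j
        by (simp add: norm_prod_square norm_vec_square)
      then show ?thesis
        using bound[of "\<lambda>j. (0, \<chi> m. y j m)"] by (simp add: norm_sum_row_column_op)
    qed
  qed
qed

subsection \<open>Combinations of the Gaussian operators\<close>

lemma gaussian_op_bounded: "gaussian_op q r \<in> bounded_ops (q_fock q)"
  unfolding gaussian_op_def
  by (intro bounded_ops_sum bounded_ops_scaleC q_fock_csubspace q_gaussian_bounded)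

lemma gaussian_op_linear:
  "gaussian_op q (\<lambda>a. r a + s a) = (\<lambda>f. gaussian_op q r f + gaussian_op q s f)"
  "gaussian_op q (\<lambda>a. b * r a) = (\<lambda>f. b *\<^sub>C gaussian_op q r f)"
  by (simp_all add: fun_eq_iff gaussian_op_def scaleC_add_left sum.distrib scaleC_sum_right scaleC_scaleC)

lemma gaussian_op_apply:
  assumes "f \<in> q_fock q"
  shows "gaussian_op q r f =
    orth_proj (q_fock q) (\<Sum>m\<in>UNIV. r m *\<^sub>C creation m f) + (\<Sum>m\<in>UNIV. r m *\<^sub>C annihilation m f)"
  by (simp add: gaussian_op_def q_gaussian_apply[OF assms] scaleC_add_right sum.distrib
      orth_proj_sum[OF q_fock_closed_csubspace] orth_proj_scaleC[OF q_fock_closed_csubspace])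

lemma creation_basis_vec: "creation m (basis_vec w) = basis_vec (m # w)"
  by (rule ell2_eqI) (auto simp: creation.rep_eq basis_vec.rep_eq split: list.split)

lemma annihilation_basis_vec_Nil: "annihilation m (basis_vec []) = 0"
  by (rule ell2_eqI) (simp add: annihilation.rep_eq basis_vec.rep_eq zero_ell2.rep_eq)

lemma gaussian_op_vacuum: "gaussian_op q r (basis_vec []) = (\<Sum>m\<in>UNIV. r m *\<^sub>C basis_vec [m])"
proof -
  have "(\<Sum>m\<in>UNIV. r m *\<^sub>C basis_vec [m]) \<in> q_fock q"
    using q_fock_csubspace[of q] basis_vec_in_q_fock[of "[_]" q]
    by (intro csubspace_sum) (auto simp: csubspace_def)
  then show ?thesis
    by (simp add: gaussian_op_apply basis_vec_in_q_fock annihilation_basis_vec_Nil creation_basis_vec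
        orth_proj_id[OF q_fock_closed_csubspace])
qed

text \<open>
  Only the annihilation part reaches the vacuum: the vacuum belongs to the q-commuting Fock space, so the
  projection preserves the vacuum component, which is 0 for vectors in the ranges of the creation operators.
\<close>

lemma gaussian_op_vacuum_component:
  assumes "f \<in> q_fock q"
  shows "Rep_ell2 (gaussian_op q r f) [] = (\<Sum>m\<in>UNIV. r m * Rep_ell2 f [m])"
proof -
  let ?v = "\<Sum>m\<in>UNIV. r m *\<^sub>C creation m f"
  have "Rep_ell2 (orth_proj (q_fock q) ?v) [] = Rep_ell2 ?v []"
    using cinner_orth_proj[OF q_fock_closed_csubspace, of "basis_vec []" q ?v]
    by (simp add: cinner_basis_vec basis_vec_in_q_fock)
  then show ?thesis
    by (simp add: gaussian_op_apply[OF assms] Rep_ell2_simps creation_Nil annihilation.rep_eq)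
qed

lemma norm_sum_one_letter: "(norm (\<Sum>a\<in>UNIV. r a *\<^sub>C basis_vec [a :: 'n::finite]))\<^sup>2 = (\<Sum>a\<in>UNIV. (cmod (r a))\<^sup>2)"
proof -
  let ?f = "\<Sum>a\<in>UNIV. r a *\<^sub>C basis_vec [a :: 'n]"
  have "annihilation b ?f = r b *\<^sub>C basis_vec []" for b
  proof (rule ell2_eqI)
    fix w show "Rep_ell2 (annihilation b ?f) w = Rep_ell2 (r b *\<^sub>C basis_vec []) w"
      by (cases "w = []")
         (simp_all add: annihilation.rep_eq Rep_ell2_simps basis_vec.rep_eq if_distrib[of "(*) _"] cong: if_cong)
  qed
  moreover have "Rep_ell2 ?f [] = 0" by (simp add: Rep_ell2_simps basis_vec.rep_eq)
  ultimately show ?thesis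
    by (simp add: norm_square_first_letter[of ?f] norm_scaleC norm_basis_vec)
qed

text \<open>
  The test vectors are multiples of the vacuum for the column, and one-particle vectors, observed through the
  vacuum component, for the row.
\<close>

lemma row_column_bound_gaussian_op:
  fixes q :: "'n::finite \<Rightarrow> 'n \<Rightarrow> complex"
  shows "row_column_bound k c (matrix_norm (q_fock q) k (\<lambda>i j. gaussian_op q (c i j)))"
  (is "row_column_bound k c ?M")
proof -
  have sub: "csubspace (q_fock q)" by (rule q_fock_csubspace)
  have bound: "(\<Sum>i<k. (norm (\<Sum>j<k. gaussian_op q (c i j) (h j)))\<^sup>2) \<le> ?M\<^sup>2 * (\<Sum>j<k. (norm (h j))\<^sup>2)"
    if "\<And>j. h j \<in> q_fock q" for h
    by (rule matrix_norm_bound) (auto simp: gaussian_op_bounded sub that)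
  show ?thesis
    unfolding row_column_bound_def
  proof (intro conjI allI)
    fix x :: "nat \<Rightarrow> complex"
    let ?h = "\<lambda>j. x j *\<^sub>C basis_vec ([] :: 'n list)"
    have h: "?h j \<in> q_fock q" for j
      using sub basis_vec_in_q_fock[of "[]" q] by (auto simp: csubspace_def)
    have "gaussian_op q (c i j) (?h j) = (\<Sum>a\<in>UNIV. (c i j a * x j) *\<^sub>C basis_vec [a])" for i j
      using gaussian_op_bounded[of q "c i j"] basis_vec_in_q_fock[of "[]" q]
      by (simp add: bounded_ops_def gaussian_op_vacuum scaleC_sum_right scaleC_scaleC mult.commute)
    then have "(\<Sum>j<k. gaussian_op q (c i j) (?h j)) = (\<Sum>a\<in>UNIV. (\<Sum>j<k. c i j a * x j) *\<^sub>C basis_vec [a])" for i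
      by (intro ell2_eqI) (simp add: Rep_ell2_simps sum_distrib_right sum.swap[of _ UNIV])
    then show "(\<Sum>i<k. \<Sum>a\<in>UNIV. (cmod (\<Sum>j<k. c i j a * x j))\<^sup>2) \<le> ?M\<^sup>2 * (\<Sum>j<k. (cmod (x j))\<^sup>2)"
      using bound[of ?h, OF h] by (simp add: norm_sum_one_letter norm_scaleC norm_basis_vec)
  next
    fix y :: "nat \<Rightarrow> 'n \<Rightarrow> complex"
    let ?h = "\<lambda>j. \<Sum>m\<in>UNIV. y j m *\<^sub>C basis_vec [m]"
    have h: "?h j \<in> q_fock q" for j
      using sub basis_vec_in_q_fock[of "[_]" q] by (intro csubspace_sum) (auto simp: csubspace_def)
    have "Rep_ell2 (\<Sum>j<k. gaussian_op q (c i j) (?h j)) [] = (\<Sum>j<k. \<Sum>m\<in>UNIV. c i j m * y j m)" for i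
      by (simp add: Rep_ell2_sum gaussian_op_vacuum_component[OF h])
         (simp add: Rep_ell2_simps basis_vec.rep_eq if_distrib[of "(*) _"] cong: if_cong)
    from norm_Rep_ell2_le[of "\<Sum>j<k. gaussian_op q (c _ j) (?h j)" "[]", unfolded this]
    have "cmod (\<Sum>j<k. \<Sum>m\<in>UNIV. c i j m * y j m) \<le> norm (\<Sum>j<k. gaussian_op q (c i j) (?h j))" for i .
    then have "(\<Sum>i<k. (cmod (\<Sum>j<k. \<Sum>m\<in>UNIV. c i j m * y j m))\<^sup>2)
        \<le> (\<Sum>i<k. (norm (\<Sum>j<k. gaussian_op q (c i j) (?h j)))\<^sup>2)"
      by (intro sum_mono power_mono) auto
    also have "\<dots> \<le> ?M\<^sup>2 * (\<Sum>j<k. (norm (?h j))\<^sup>2)" by (rule bound[OF h])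
    finally show "(\<Sum>i<k. (cmod (\<Sum>j<k. \<Sum>m\<in>UNIV. c i j m * y j m))\<^sup>2)
        \<le> ?M\<^sup>2 * (\<Sum>j<k. \<Sum>m\<in>UNIV. (cmod (y j m))\<^sup>2)"
      by (simp add: norm_sum_one_letter)
  qed
qed

text \<open>
  This transports an inequality about scalars to vectors of the Fock space, one basis word at a time; it plays
  the part of tensoring with the identity.
\<close>

lemma sum_norm_square_mono_pointwise:
  fixes F :: "'i \<Rightarrow> 'a ell2" and G :: "'j \<Rightarrow> 'a ell2"
  assumes le: "\<And>w. (\<Sum>i\<in>I. (cmod (Rep_ell2 (F i) w))\<^sup>2) \<le> C * (\<Sum>j\<in>J. (cmod (Rep_ell2 (G j) w))\<^sup>2)"
  shows "(\<Sum>i\<in>I. (norm (F i))\<^sup>2) \<le> C * (\<Sum>j\<in>J. (norm (G j))\<^sup>2)"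
proof -
  have hs: "((\<lambda>w. (cmod (Rep_ell2 f w))\<^sup>2) has_sum (norm f)\<^sup>2) UNIV" for f :: "'a ell2"
    using square_summable_Rep_ell2[of f] unfolding square_summable_def norm_ell2_square by (rule has_sum_infsum)
  have sum_hs: "((\<lambda>w. \<Sum>i\<in>I. (cmod (Rep_ell2 (H i) w))\<^sup>2) has_sum (\<Sum>i\<in>I. (norm (H i))\<^sup>2)) UNIV"
    for I and H :: "'k \<Rightarrow> 'a ell2"
    by (induction I rule: infinite_finite_induct) (simp_all add: has_sum_add hs)
  show ?thesis
    by (rule has_sum_mono[OF sum_hs has_sum_cmult_right[OF sum_hs] le])
qed

text \<open>
  The creation part \<open>V\<close> and the annihilation part \<open>L\<close> are each bounded by \<open>M\<close>, by the column and by the row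
  estimate respectively. The projection does not increase norms, and the triangle inequality costs the factor 2.
\<close>

lemma matrix_norm_gaussian_op_le:
  fixes q :: "'n::finite \<Rightarrow> 'n \<Rightarrow> complex"
  assumes M: "row_column_bound k c M" "0 \<le> M"
  shows "matrix_norm (q_fock q) k (\<lambda>i j. gaussian_op q (c i j)) \<le> 2 * M"
proof (rule matrix_norm_leI[OF q_fock_csubspace])
  fix h :: "nat \<Rightarrow> 'n list ell2"
  assume h: "\<And>j. j < k \<Longrightarrow> h j \<in> q_fock q"
  define V where "V i = (\<Sum>j<k. \<Sum>m\<in>UNIV. c i j m *\<^sub>C creation m (h j))" for i
  define L where "L i = (\<Sum>j<k. \<Sum>m\<in>UNIV. c i j m *\<^sub>C annihilation m (h j))" for i
  have split: "(\<Sum>j<k. gaussian_op q (c i j) (h j)) = orth_proj (q_fock q) (V i) + L i" for i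
    using h by (simp add: gaussian_op_apply V_def L_def sum.distrib orth_proj_sum[OF q_fock_closed_csubspace])
  have "(norm (orth_proj (q_fock q) (V i) + L i))\<^sup>2 \<le> 2 * (norm (V i))\<^sup>2 + 2 * (norm (L i))\<^sup>2" for i
  proof -
    have "(norm (orth_proj (q_fock q) (V i) + L i))\<^sup>2 \<le> (norm (V i) + norm (L i))\<^sup>2"
      using norm_orth_proj_le[OF q_fock_closed_csubspace, of q "V i"]
      by (intro power_mono order_trans[OF norm_triangle_ineq]) auto
    also have "\<dots> \<le> 2 * (norm (V i))\<^sup>2 + 2 * (norm (L i))\<^sup>2"
      using sum_squares_bound[of "norm (V i)" "norm (L i)"] by (simp add: power2_sum)
    finally show ?thesis .
  qed
  then have "(\<Sum>i<k. (norm (\<Sum>j<k. gaussian_op q (c i j) (h j)))\<^sup>2)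
      \<le> 2 * (\<Sum>i<k. (norm (V i))\<^sup>2) + 2 * (\<Sum>i<k. (norm (L i))\<^sup>2)"
    unfolding split sum_distrib_left sum.distrib[symmetric] by (rule sum_mono)
  moreover have "(\<Sum>i<k. (norm (V i))\<^sup>2) \<le> M\<^sup>2 * (\<Sum>j<k. (norm (h j))\<^sup>2)"
  proof -
    \<comment> \<open>Splitting off the first letter of \<open>V i\<close> recovers the column applied to \<open>h\<close>.\<close>
    have "annihilation a (V i) = (\<Sum>j<k. c i j a *\<^sub>C h j)" for i a
      by (simp add: V_def annihilation_sum annihilation_scaleC annihilation_creation
          if_distrib[of "(*\<^sub>C) _"] cong: if_cong)
    moreover have "Rep_ell2 (V i) [] = 0" for i
      by (simp add: V_def Rep_ell2_simps creation_Nil)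
    ultimately have "(\<Sum>i<k. (norm (V i))\<^sup>2)
        = (\<Sum>p\<in>{..<k} \<times> UNIV. (norm (\<Sum>j<k. c (fst p) j (snd p) *\<^sub>C h j))\<^sup>2)"
      by (simp add: norm_square_first_letter[of "V _"] sum.cartesian_product case_prod_beta)
    also have "\<dots> \<le> M\<^sup>2 * (\<Sum>j<k. (norm (h j))\<^sup>2)"
    proof (rule sum_norm_square_mono_pointwise)
      fix w
      have "(\<Sum>i<k. \<Sum>a\<in>UNIV. (cmod (\<Sum>j<k. c i j a * Rep_ell2 (h j) w))\<^sup>2)
          \<le> M\<^sup>2 * (\<Sum>j<k. (cmod (Rep_ell2 (h j) w))\<^sup>2)"
        using M unfolding row_column_bound_def by (elim conjE) (erule allE[of _ "\<lambda>j. Rep_ell2 (h j) w"])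
      then show "(\<Sum>p\<in>{..<k} \<times> UNIV. (cmod (Rep_ell2 (\<Sum>j<k. c (fst p) j (snd p) *\<^sub>C h j) w))\<^sup>2)
          \<le> M\<^sup>2 * (\<Sum>j<k. (cmod (Rep_ell2 (h j) w))\<^sup>2)"
        by (simp add: Rep_ell2_simps sum.cartesian_product case_prod_beta)
    qed
    finally show ?thesis .
  qed
  moreover have "(\<Sum>i<k. (norm (L i))\<^sup>2) \<le> M\<^sup>2 * (\<Sum>j<k. (norm (h j))\<^sup>2)"
  proof -
    have "(\<Sum>i<k. (norm (L i))\<^sup>2)
        \<le> M\<^sup>2 * (\<Sum>p\<in>{..<k} \<times> UNIV. (norm (annihilation (snd p) (h (fst p))))\<^sup>2)"
    proof (rule sum_norm_square_mono_pointwise)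
      fix w
      have "(\<Sum>i<k. (cmod (\<Sum>j<k. \<Sum>m\<in>UNIV. c i j m * Rep_ell2 (h j) (m # w)))\<^sup>2)
          \<le> M\<^sup>2 * (\<Sum>j<k. \<Sum>m\<in>UNIV. (cmod (Rep_ell2 (h j) (m # w)))\<^sup>2)"
        using M unfolding row_column_bound_def by (elim conjE) (erule allE[of _ "\<lambda>j m. Rep_ell2 (h j) (m # w)"])
      then show "(\<Sum>i<k. (cmod (Rep_ell2 (L i) w))\<^sup>2)
          \<le> M\<^sup>2 * (\<Sum>p\<in>{..<k} \<times> UNIV. (cmod (Rep_ell2 (annihilation (snd p) (h (fst p))) w))\<^sup>2)"
        by (simp add: L_def Rep_ell2_simps annihilation.rep_eq sum.cartesian_product case_prod_beta)
    qed
    also have "\<dots> = M\<^sup>2 * (\<Sum>j<k. \<Sum>m\<in>UNIV. (norm (annihilation m (h j)))\<^sup>2)"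
      by (simp add: sum.cartesian_product case_prod_beta)
    also have "\<dots> \<le> M\<^sup>2 * (\<Sum>j<k. (norm (h j))\<^sup>2)"
      by (intro mult_left_mono sum_mono) (simp_all add: norm_square_first_letter[of "h _"])
    finally show ?thesis .
  qed
  ultimately have "(\<Sum>i<k. (norm (\<Sum>j<k. gaussian_op q (c i j) (h j)))\<^sup>2)
      \<le> 2 * (M\<^sup>2 * (\<Sum>j<k. (norm (h j))\<^sup>2)) + 2 * (M\<^sup>2 * (\<Sum>j<k. (norm (h j))\<^sup>2))"
    by linarith
  then show "(\<Sum>i<k. (norm (\<Sum>j<k. gaussian_op q (c i j) (h j)))\<^sup>2) \<le> (2 * M)\<^sup>2 * (\<Sum>j<k. (norm (h j))\<^sup>2)"
    by (simp add: power_mult_distrib)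
qed (use M in simp)


section \<open>The complete isomorphism\<close>

lemma operator_space_range:
  assumes "closed_csubspace N" "\<And>r. T r \<in> bounded_ops N"
    and "\<And>r s. T (\<lambda>a. r a + s a) = (\<lambda>x. T r x + T s x)" "\<And>b r. T (\<lambda>a. b * r a) = (\<lambda>x. b *\<^sub>C T r x)"
  shows "operator_space N (range (T :: ('n \<Rightarrow> complex) \<Rightarrow> _))"
  unfolding operator_space_def
proof (intro conjI ballI allI)
  have "(\<lambda>_. 0) = T (\<lambda>a. 0 * 0)" by (subst assms(4)) simp
  then show "(\<lambda>_. 0) \<in> range T" by (metis rangeI)
qed (use assms in \<open>auto simp flip: assms(3,4)\<close>)

lemma inj_gaussian_op: "inj (gaussian_op q)"
proof (rule injI)
  fix r s assume "gaussian_op q r = gaussian_op q s"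
  then have "Rep_ell2 (gaussian_op q r (basis_vec [])) [a] = Rep_ell2 (gaussian_op q s (basis_vec [])) [a]" for a
    by simp
  then show "r = s"
    by (simp add: gaussian_op_vacuum Rep_ell2_simps basis_vec.rep_eq fun_eq_iff if_distrib[of "(*) _"] cong: if_cong)
qed

theorem theorem20:
  fixes q :: "'n::finite \<Rightarrow> 'n \<Rightarrow> complex" and i1 :: 'n
  assumes "CARD('n) \<ge> 2"
    and "\<And>i j. cmod (q i j) = 1"
    and "\<And>i. q i i = 1"
    and "\<And>i j. q j i = inverse (q i j)"
  shows "completely_isomorphic (q_fock q) (cspan_family (q_gaussian q)) UNIV (E_space i1)"
proof -
  let ?G = "gaussian_op q" and ?E = "row_column_op i1"
  \<comment> \<open>The coefficients of an operator in the span are unique, as they can be read off from its value at the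
    vacuum; \<open>\<phi>\<close> carries them over.\<close>
  define \<phi> where "\<phi> T = ?E (inv ?G T)" for T
  have \<phi>: "\<phi> (?G r) = ?E r" for r by (simp add: \<phi>_def inj_gaussian_op)
  have bij: "bij_betw \<phi> (range ?G) (range ?E)"
    using inj_gaussian_op[of q] inj_row_column_op[of i1]
    by (auto simp: bij_betw_def inj_on_def image_image \<phi>)
  have inv: "inv_into (range ?G) \<phi> (?E r) = ?G r" for r
    using inv_into_f_f[OF bij_betw_imp_inj_on[OF bij], of "?G r"] by (simp add: \<phi>)
  have "operator_space (q_fock q) (range ?G)"
    by (intro operator_space_range q_fock_closed_csubspace gaussian_op_bounded gaussian_op_linear)
  moreover have "operator_space UNIV (range ?E)"
    by (intro operator_space_range row_column_op_bounded row_column_op_linear)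
       (simp add: closed_csubspace_def csubspace_def)
  moreover have "linear_map_on (range ?G) \<phi>"
    unfolding linear_map_on_def
    by (auto simp: \<phi> gaussian_op_linear[symmetric] row_column_op_linear[symmetric])
  moreover have "completely_bounded (q_fock q) (range ?G) UNIV \<phi>"
    unfolding completely_bounded_def
  proof (intro exI allI impI)
    fix k and A :: "nat \<Rightarrow> nat \<Rightarrow> 'n list ell2 \<Rightarrow> 'n list ell2"
    assume A: "\<forall>i<k. \<forall>j<k. A i j \<in> range ?G"
    define c where "c i j = inv ?G (A i j)" for i j
    have c: "A i j = ?G (c i j)" if "i < k" "j < k" for i j
      using A that by (simp add: c_def f_inv_into_f)
    have "matrix_norm UNIV k (\<lambda>i j. \<phi> (A i j)) = matrix_norm UNIV k (\<lambda>i j. ?E (c i j))"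
      by (rule matrix_norm_cong) (simp add: c \<phi>)
    also have "\<dots> \<le> matrix_norm (q_fock q) k (\<lambda>i j. ?G (c i j))"
      by (intro row_column_bound_matrix_norm_le row_column_bound_gaussian_op matrix_norm_nonneg
          q_fock_csubspace gaussian_op_bounded)
    also have "\<dots> = matrix_norm (q_fock q) k A"
      by (rule matrix_norm_cong) (simp add: c)
    finally show "matrix_norm UNIV k (\<lambda>i j. \<phi> (A i j)) \<le> 1 * matrix_norm (q_fock q) k A" by simp
  qed
  moreover have "completely_bounded UNIV (range ?E) (q_fock q) (inv_into (range ?G) \<phi>)"
    unfolding completely_bounded_def
  proof (intro exI allI impI)
    fix k and A :: "nat \<Rightarrow> nat \<Rightarrow> (complex ^ 'n) \<times> (complex ^ 'n) \<Rightarrow> (complex ^ 'n) \<times> (complex ^ 'n)"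
    assume A: "\<forall>i<k. \<forall>j<k. A i j \<in> range ?E"
    define c where "c i j = inv ?E (A i j)" for i j
    have c: "A i j = ?E (c i j)" if "i < k" "j < k" for i j
      using A that by (simp add: c_def f_inv_into_f)
    have "matrix_norm (q_fock q) k (\<lambda>i j. inv_into (range ?G) \<phi> (A i j))
        = matrix_norm (q_fock q) k (\<lambda>i j. ?G (c i j))"
      by (rule matrix_norm_cong) (simp add: c inv)
    also have "\<dots> \<le> 2 * matrix_norm UNIV k (\<lambda>i j. ?E (c i j))"
      by (intro matrix_norm_gaussian_op_le row_column_bound_row_column_op matrix_norm_nonneg
          row_column_op_bounded) (simp add: csubspace_def)
    also have "matrix_norm UNIV k (\<lambda>i j. ?E (c i j)) = matrix_norm UNIV k A"
      by (rule matrix_norm_cong) (simp add: c)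
    finally show "matrix_norm (q_fock q) k (\<lambda>i j. inv_into (range ?G) \<phi> (A i j))
        \<le> 2 * matrix_norm UNIV k A" .
  qed
  ultimately show ?thesis
    unfolding completely_isomorphic_def cspan_q_gaussian_eq E_space_eq using bij by blast
qed

end
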